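(* The tetrahedron determines a symmetric tiling of $\mathbb{S}^2$ whose prototile is a spherical right-angle triangle with angles $\left(\frac{\pi}{2},\frac{\pi}{3},\frac{\pi}{3}\right)$. The cube and the octahedron determine the same symmetric tiling of $\mathbb{S}^2$ (up to an isometry of $\mathbb{S}^2$), whose prototile is a spherical right-angle triangle with angles $\left(\frac{\pi}{2},\frac{\pi}{3},\frac{\pi}{4}\right)$. Finally, the dodecahedron and the icosahedron determine the same symmetric tiling of $\mathbb{S}^2$ (up to an isometry of $\mathbb{S}^2$), whose prototile is a spherical right-angle triangle with angles $\left(\frac{\pi}{2},\frac{\pi}{3},\frac{\pi}{5}\right)$.
   Context: $\mathbb{S}^2$ is the unit sphere in $\mathbb{R}^3$ with the round metric. The tetrahedron, cube, octahedron, dodecahedron and icosahedron are the five Platonic solids (convex regular polyhedra). The tiling of $\mathbb{S}^2$ determined by a Platonic solid $\mathfrak{P}$ is obtained as follows: place $\mathfrak{P}$ concentrically inside $\mathbb{S}^2$, so that its centre of symmetry is the origin and $\mathbb{S}^2$ is its circumscribed sphere; take the barycentric subdivision of every face of $\mathfrak{P}$ (join the centre of the face to the vertices of the face and to the midpoints of its edges); and project the resulting triangles radially from the origin to $\mathbb{S}^2$. A tiling (tessellation) $\mathcal{T}$ of $\mathbb{S}^2$ is a subdivision of $\mathbb{S}^2$ into spherical polygons, called tiles, which cover $\mathbb{S}^2$ and have pairwise disjoint interiors. It is symmetric if for any two tiles $t,\tau$ there is an isometry $g$ of $\mathbb{S}^2$ which maps $\mathcal{T}$ to itself and satisfies $g\cdot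 t=\tau$. In a symmetric tiling all tiles are congruent to a single polygon, called the prototile. *)

theory Defs
  imports "HOL-Analysis.Analysis"
begin

section \<open>Geometry of the round sphere\<close>

abbreviation S2 :: "(real^3) set"
  where "S2 \<equiv> sphere 0 1"

text \<open>Geodesic distance of the round metric, for points of \<^term>\<open>S2\<close>.\<close>

definition sph_dist :: "real^3 \<Rightarrow> real^3 \<Rightarrow> real"
  where "sph_dist x y = arccos (x \<bullet> y)"

text \<open>Only the values of \<open>g\<close> on \<^term>\<open>S2\<close> matter.\<close>

definition sph_isometry :: "(real^3 \<Rightarrow> real^3) \<Rightarrow> bool"
  where "sph_isometry g \<longleftrightarrow>
    g ` S2 = S2 \<and> (\<forall>x\<in>S2. \<forall>y\<in>S2. sph_dist (g x) (g y) = sph_dist x y)"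

text \<open>The radial projection from the origin is the library function
  \<^term>\<open>sgn :: real^3 \<Rightarrow> real^3\<close>, which sends \<open>x\<close> to \<open>x /\<^sub>R norm x\<close> (and \<open>0\<close> to \<open>0\<close>).
  For distinct, non-antipodal \<open>a\<close>, \<open>b\<close> in \<^term>\<open>S2\<close> the chord from \<open>a\<close> to \<open>b\<close> misses the
  origin and projects onto the minimal geodesic arc from \<open>a\<close> to \<open>b\<close>.\<close>

definition geodesic_arc :: "(real^3) set \<Rightarrow> bool"
  where "geodesic_arc s \<longleftrightarrow>
    (\<exists>a\<in>S2. \<exists>b\<in>S2. a \<noteq> b \<and> a \<noteq> - b \<and> s = sgn ` closed_segment a b)"

text \<open>A spherical polygon is a closed topological disc in the sphere whose boundary
  consists of finitely many geodesic arcs; it need not be convex.\<close>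

definition spherical_polygon :: "(real^3) set \<Rightarrow> bool"
  where "spherical_polygon t \<longleftrightarrow>
    t \<subseteq> S2 \<and> t homeomorphic cball (0::real^2) 1 \<and>
    (\<exists>A. finite A \<and> (\<forall>s\<in>A. geodesic_arc s) \<and> top_of_set S2 frontier_of t = \<Union>A)"

text \<open>The angle at \<open>B\<close> between the geodesic arcs from \<open>B\<close> to \<open>A\<close> and from \<open>B\<close> to \<open>C\<close>:
  \<open>u\<close> and \<open>w\<close> are tangent to these arcs at \<open>B\<close>.\<close>

definition sph_angle :: "real^3 \<Rightarrow> real^3 \<Rightarrow> real^3 \<Rightarrow> real"
  where "sph_angle A B C =
    (let u = A - (A \<bullet> B) *\<^sub>R B; w = C - (C \<bullet> B) *\<^sub>R B
     in arccos ((u \<bullet> w) / (norm u * norm w)))"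

definition spherical_triangle :: "(real^3) set \<Rightarrow> real \<Rightarrow> real \<Rightarrow> real \<Rightarrow> bool"
  where "spherical_triangle Q \<alpha> \<beta> \<gamma> \<longleftrightarrow>
    (\<exists>A\<in>S2. \<exists>B\<in>S2. \<exists>C\<in>S2. card {A, B, C} = 3 \<and> independent {A, B, C} \<and>
       Q = sgn ` (convex hull {A, B, C}) \<and>
       sph_angle B A C = \<alpha> \<and> sph_angle A B C = \<beta> \<and> sph_angle A C B = \<gamma>)"


section \<open>Tilings of the sphere\<close>

definition tiling :: "(real^3) set set \<Rightarrow> bool"
  where "tiling T \<longleftrightarrow>
    (\<forall>t\<in>T. spherical_polygon t) \<and> \<Union>T = S2 \<and>
    pairwise (\<lambda>t \<tau>. disjnt (top_of_set S2 interior_of t) (top_of_set S2 interior_of \<tau>)) T"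

definition symmetric_tiling :: "(real^3) set set \<Rightarrow> bool"
  where "symmetric_tiling T \<longleftrightarrow>
    tiling T \<and> (\<forall>t\<in>T. \<forall>\<tau>\<in>T. \<exists>g. sph_isometry g \<and> (`) g ` T = T \<and> g ` t = \<tau>)"

definition prototile :: "(real^3) set set \<Rightarrow> (real^3) set \<Rightarrow> bool"
  where "prototile T Q \<longleftrightarrow>
    spherical_polygon Q \<and> (\<forall>t\<in>T. \<exists>g. sph_isometry g \<and> g ` t = Q)"

definition same_up_to_isometry :: "(real^3) set set \<Rightarrow> (real^3) set set \<Rightarrow> bool"
  where "same_up_to_isometry T T' \<longleftrightarrow> (\<exists>g. sph_isometry g \<and> (`) g ` T = T')"


section \<open>Platonic solids\<close>

text \<open>A regular \<open>p\<close>-gon of circumradius \<open>r\<close> in space: \<open>p\<close> equally spaced points on a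
  circle with centre \<open>c\<close> in the affine plane through \<open>c\<close> with orthonormal directions \<open>a\<close>, \<open>b\<close>.\<close>

definition regular_polygon :: "nat \<Rightarrow> real \<Rightarrow> (real^3) set \<Rightarrow> bool"
  where "regular_polygon p r F \<longleftrightarrow> p \<ge> 3 \<and> r > 0 \<and>
    (\<exists>c a b. norm a = 1 \<and> norm b = 1 \<and> a \<bullet> b = 0 \<and>
       F = convex hull
         ((\<lambda>k. c + r *\<^sub>R (cos (2 * pi * real k / real p) *\<^sub>R a
                          + sin (2 * pi * real k / real p) *\<^sub>R b)) ` {..<p}))"

text \<open>Convex regular polyhedra: the faces are congruent regular \<open>p\<close>-gons (congruence of
  regular \<open>p\<close>-gons means equality of circumradii) and \<open>q\<close> faces meet at every vertex.
  The five pairs \<open>(p, q)\<close> below give the five solids, each of them up to similarity.\<close>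

definition platonic_solid :: "nat \<Rightarrow> nat \<Rightarrow> (real^3) set \<Rightarrow> bool"
  where "platonic_solid p q P \<longleftrightarrow>
    polytope P \<and> aff_dim P = 3 \<and>
    (\<exists>r. \<forall>F. F facet_of P \<longrightarrow> regular_polygon p r F) \<and>
    (\<forall>v. v extreme_point_of P \<longrightarrow> card {F. F facet_of P \<and> v \<in> F} = q)"

definition tetrahedron :: "(real^3) set \<Rightarrow> bool"
  where "tetrahedron P \<longleftrightarrow> platonic_solid 3 3 P"

definition cube :: "(real^3) set \<Rightarrow> bool"
  where "cube P \<longleftrightarrow> platonic_solid 4 3 P"

definition octahedron :: "(real^3) set \<Rightarrow> bool"
  where "octahedron P \<longleftrightarrow> platonic_solid 3 4 P"

definition dodecahedron :: "(real^3) set \<Rightarrow> bool"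
  where "dodecahedron P \<longleftrightarrow> platonic_solid 5 3 P"

definition icosahedron :: "(real^3) set \<Rightarrow> bool"
  where "icosahedron P \<longleftrightarrow> platonic_solid 3 5 P"

text \<open>The centre of a polytope is the mean of its vertices, which every symmetry of the
  polytope fixes. It is the midpoint of an edge, the centre \<open>c\<close> of a regular polygon, and
  the centre of symmetry of a Platonic solid.\<close>

definition centre :: "(real^3) set \<Rightarrow> real^3"
  where "centre F = (\<Sum>v | v extreme_point_of F. v) /\<^sub>R real (card {v. v extreme_point_of F})"

definition concentrically_inscribed :: "(real^3) set \<Rightarrow> bool"
  where "concentrically_inscribed P \<longleftrightarrow>
    centre P = 0 \<and> (\<forall>v. v extreme_point_of P \<longrightarrow> v \<in> S2)"

text \<open>One triangle of the barycentric subdivision of the face \<open>F\<close> for every edge \<open>e\<close> of \<open>F\<close>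
  and every end point \<open>v\<close> of \<open>e\<close>.\<close>

definition solid_tiling :: "(real^3) set \<Rightarrow> (real^3) set set"
  where "solid_tiling P =
    {sgn ` (convex hull {v, centre e, centre F}) | v e F.
       F facet_of P \<and> e edge_of F \<and> v extreme_point_of e}"

end

theory Submission
  imports Defs
begin

text \<open>All five solids are treated at once, as solids with regular \<open>p\<close>-gons for faces, \<open>q\<close> of them
at each vertex. A flag consists of a face \<open>F\<close>, an edge \<open>e\<close> of \<open>F\<close> and an end point \<open>v\<close> of \<open>e\<close>, and
gives rise to one tile: the spherical triangle whose vertices are \<open>v\<close> and the projections of the
centres of \<open>e\<close> and \<open>F\<close>.

The hypotheses on the solid are local, but the circumscribed sphere makes them rigid. As all
vertices have norm \<open>1\<close> and all faces the same circumradius, the centres of the faces are the feet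
of the perpendiculars from the origin and have the same distance from it; the edges have equal
length. Hence all flags give congruent triples of unit vectors, with a right angle at the second
one (\<open>flag_right_triple\<close>). Moreover each entry of a flag can be exchanged: the vertex for the other
end of the edge, the edge for the other edge of the face at the vertex, the face for the other
face at the edge. Any two flags are joined by exchanges, because the boundary of the solid stays
connected when the vertices are removed (\<open>facets_connected\<close>).

The symmetries are found without looking at the solid any more. When one entry of a triple is
exchanged, the new entry has the same norm and the same inner products with the other two, so
that it is the mirror image of the old one in their plane. An orthogonal map that carries one
flag to another therefore carries neighbours to neighbours, and by connectedness all flags to all
flags (\<open>chamber_systems_congruent\<close>). This makes the tiling symmetric. It also shows that the
tilings of two solids are the same up to an isometry as soon as their flags give congruent triples.

It remains to find the angles of a tile. The angle at the centre of a face is half the central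
angle of an edge of a regular \<open>p\<close>-gon. At a vertex, the centres of the \<open>q\<close> faces around it lie on
a circle, and each is obtained from the previous one by a turn through twice the angle of the
tile; so \<open>q\<close> such turns make a full circle (\<open>vertex_angle_count\<close>). The angles determine the sides
of the triangle, and interchanging \<open>p\<close> and \<open>q\<close> interchanges its legs. Thus the flags of the solid
\<open>(q, p)\<close> are, read backwards, congruent to those of \<open>(p, q)\<close>.

The tiles cover the sphere because the ray from the origin meets a face, and in it the ray from
its centre meets an edge (\<open>triangles_cover\<close>). Their interiors are disjoint since a point inside a
tile is strictly closer to the centre of its face than to those of the other faces, to the midpoint
of its edge than to those of the other edges of this face, and to its vertex than to the other end
of this edge (\<open>interior_determines_flag\<close>).\<close>

section \<open>Spherical triangles\<close>

text \<open>Linear coordinates with respect to a basis. The last clause is an equivalence, so that the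
coefficients in a given linear combination can be read off by rewriting.\<close>

lemma triple_coordinates:
  fixes a b c :: "real^3"
  assumes card: "card {a, b, c} = 3" and ind: "independent {a, b, c}"
  obtains f g h :: "real^3 \<Rightarrow> real" where
    "linear f" "linear g" "linear h"
    "f a = 1" "f b = 0" "f c = 0" "g a = 0" "g b = 1" "g c = 0" "h a = 0" "h b = 0" "h c = 1"
    "\<And>x k l m. x = k *\<^sub>R a + l *\<^sub>R b + m *\<^sub>R c \<longleftrightarrow> k = f x \<and> l = g x \<and> m = h x"
proof -
  have ne: "a \<noteq> b" "b \<noteq> c" "a \<noteq> c"
    using card by (auto simp: card_insert_if split: if_splits)
  have ext: "\<exists>f::real^3 \<Rightarrow> real. linear f \<and> (\<forall>y\<in>{a, b, c}. f y = (if y = v then 1 else 0))" for v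
    using linear_independent_extend [OF ind, of "\<lambda>y. if y = v then 1 else (0::real)"] by auto
  obtain f :: "real^3 \<Rightarrow> real" where f: "linear f" "\<forall>y\<in>{a, b, c}. f y = (if y = a then 1 else 0)"
    using ext by blast
  obtain g :: "real^3 \<Rightarrow> real" where g: "linear g" "\<forall>y\<in>{a, b, c}. g y = (if y = b then 1 else 0)"
    using ext by blast
  obtain h :: "real^3 \<Rightarrow> real" where h: "linear h" "\<forall>y\<in>{a, b, c}. h y = (if y = c then 1 else 0)"
    using ext by blast
  have val: "f a = 1" "f b = 0" "f c = 0" "g a = 0" "g b = 1" "g c = 0" "h a = 0" "h b = 0" "h c = 1"
    using f(2) g(2) h(2) ne by auto
  have "dim {a, b, c} = 3"
    using dim_eq_card_independent [OF ind] card by simp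
  then have span: "span {a, b, c} = UNIV"
    using dim_eq_full [of "{a, b, c}"] by simp
  have uniq: "f (k *\<^sub>R a + l *\<^sub>R b + m *\<^sub>R c) = k" "g (k *\<^sub>R a + l *\<^sub>R b + m *\<^sub>R c) = l"
    "h (k *\<^sub>R a + l *\<^sub>R b + m *\<^sub>R c) = m" for k l m
    using f(1) g(1) h(1) val by (simp_all add: linear_add linear_scale)
  have exp: "x = f x *\<^sub>R a + g x *\<^sub>R b + h x *\<^sub>R c" for x
  proof -
    have "x \<in> span {a, b, c}"
      by (simp add: span)
    then obtain k l m where "x - k *\<^sub>R a - l *\<^sub>R b - m *\<^sub>R c = 0"
      unfolding span_insert by auto
    then have x: "x = k *\<^sub>R a + l *\<^sub>R b + m *\<^sub>R c"
      by (simp add: algebra_simps)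
    have "f x = k" "g x = l" "h x = m"
      unfolding x by (fact uniq)+
    then show ?thesis
      using x by simp
  qed
  have "x = k *\<^sub>R a + l *\<^sub>R b + m *\<^sub>R c \<longleftrightarrow> k = f x \<and> l = g x \<and> m = h x" for x k l m
    using uniq [of k l m] exp [of x] by auto
  with f(1) g(1) h(1) val show thesis
    by (rule that)
qed

lemma independent_tripleI:
  fixes a b c :: "real^3"
  assumes "\<And>k l m. k *\<^sub>R a + l *\<^sub>R b + m *\<^sub>R c = 0 \<Longrightarrow> k = 0 \<and> l = 0 \<and> m = 0"
  shows "card {a, b, c} = 3" "independent {a, b, c}"
proof -
  have ne: "a \<noteq> b" "b \<noteq> c" "a \<noteq> c"
    using assms [of 1 "-1" 0] assms [of 0 1 "-1"] assms [of 1 0 "-1"] by auto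
  then show "card {a, b, c} = 3"
    by simp
  show "independent {a, b, c}"
    unfolding dependent_finite [OF finite.insertI [OF finite.insertI [OF finite.insertI [OF finite.emptyI]]]]
  proof clarify
    fix u :: "real^3 \<Rightarrow> real" and v
    assume v: "v \<in> {a, b, c}" "u v \<noteq> 0" and "(\<Sum>v\<in>{a, b, c}. u v *\<^sub>R v) = 0"
    then have "u a *\<^sub>R a + u b *\<^sub>R b + u c *\<^sub>R c = 0"
      using ne by (simp add: add.assoc)
    then have "u a = 0 \<and> u b = 0 \<and> u c = 0"
      by (rule assms)
    then show False
      using v by auto
  qed
qed

lemma zero_notin_hull_triple:
  fixes a b c :: "real^3"
  assumes "card {a, b, c} = 3" "independent {a, b, c}"
  shows "0 \<notin> convex hull {a, b, c}"
proof
  assume "0 \<in> convex hull {a, b, c}"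
  then obtain u v w where *: "0 = u *\<^sub>R a + v *\<^sub>R b + w *\<^sub>R c" "u + v + w = 1"
    unfolding convex_hull_3 by auto
  obtain f g h :: "real^3 \<Rightarrow> real" where fgh: "linear f" "linear g" "linear h"
    and "f a = 1" "f b = 0" "f c = 0" "g a = 0" "g b = 1" "g c = 0" "h a = 0" "h b = 0" "h c = 1"
    and coords: "\<And>x k l m. x = k *\<^sub>R a + l *\<^sub>R b + m *\<^sub>R c \<longleftrightarrow> k = f x \<and> l = g x \<and> m = h x"
    by (rule triple_coordinates [OF assms]) (rule that)
  have "u = f 0" "v = g 0" "w = h 0"
    using *(1) coords [of 0 u v w] by auto
  then show False
    using *(2) linear_0 [OF fgh(1)] linear_0 [OF fgh(2)] linear_0 [OF fgh(3)] by simp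
qed

text \<open>The spherical triangle is the part of the sphere in the cone over the plane triangle. It
therefore depends only on the rays through the three points, and a choice of coordinates
turns it into a system of linear inequalities.\<close>

lemma sgn_hull_eq_cone:
  fixes a b c :: "real^3"
  assumes "0 \<notin> convex hull {a, b, c}"
  shows "sgn ` (convex hull {a, b, c}) =
    {x \<in> S2. \<exists>k l m. 0 \<le> k \<and> 0 \<le> l \<and> 0 \<le> m \<and> x = k *\<^sub>R a + l *\<^sub>R b + m *\<^sub>R c}"
    (is "_ = ?R")
proof (intro equalityI subsetI)
  fix x assume "x \<in> sgn ` (convex hull {a, b, c})"
  then obtain y where y: "y \<in> convex hull {a, b, c}" "x = sgn y"
    by auto
  then have "y \<noteq> 0"
    using assms by auto
  obtain u v w where uvw: "0 \<le> u" "0 \<le> v" "0 \<le> w" "y = u *\<^sub>R a + v *\<^sub>R b + w *\<^sub>R c"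
    using y(1) unfolding convex_hull_3 by auto
  then have "x = (u / norm y) *\<^sub>R a + (v / norm y) *\<^sub>R b + (w / norm y) *\<^sub>R c"
    by (simp add: y(2) sgn_div_norm scaleR_add_right divide_inverse mult.commute)
  moreover have "0 \<le> u / norm y" "0 \<le> v / norm y" "0 \<le> w / norm y"
    using uvw by auto
  moreover have "x \<in> S2"
    using y(2) \<open>y \<noteq> 0\<close> by (simp add: norm_sgn)
  ultimately show "x \<in> ?R"
    by blast
next
  fix x assume "x \<in> ?R"
  then obtain u v w where x: "norm x = 1" "0 \<le> u" "0 \<le> v" "0 \<le> w" "x = u *\<^sub>R a + v *\<^sub>R b + w *\<^sub>R c"
    by auto
  define s where "s = u + v + w"
  have "s \<noteq> 0"
  proof
    assume "s = 0"
    then have "u = 0 \<and> v = 0 \<and> w = 0"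
      using x(2-4) unfolding s_def by linarith
    then show False
      using x by simp
  qed
  then have "s > 0"
    using x(2-4) unfolding s_def by linarith
  have "inverse s *\<^sub>R x = (u / s) *\<^sub>R a + (v / s) *\<^sub>R b + (w / s) *\<^sub>R c"
    by (simp add: x(5) scaleR_add_right divide_inverse mult.commute)
  moreover have "0 \<le> u / s" "0 \<le> v / s" "0 \<le> w / s" "u / s + v / s + w / s = 1"
    using x(2-4) \<open>s > 0\<close> by (auto simp: s_def add_divide_distrib [symmetric])
  ultimately have "inverse s *\<^sub>R x \<in> convex hull {a, b, c}"
    unfolding convex_hull_3 by blast
  moreover have "sgn (inverse s *\<^sub>R x) = x"
    using \<open>s > 0\<close> x(1) by (simp add: sgn_scaleR sgn_div_norm)
  ultimately show "x \<in> sgn ` (convex hull {a, b, c})"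
    by force
qed

lemma sgn_hull_triple_interior:
  fixes a b c :: "real^3"
  assumes card: "card {a, b, c} = 3" and ind: "independent {a, b, c}"
  shows "top_of_set S2 interior_of (sgn ` (convex hull {a, b, c})) =
    {x \<in> S2. \<exists>k l m. 0 < k \<and> 0 < l \<and> 0 < m \<and> x = k *\<^sub>R a + l *\<^sub>R b + m *\<^sub>R c}"
    (is "_ = ?R")
proof -
  obtain f g h :: "real^3 \<Rightarrow> real" where lin: "linear f" "linear g" "linear h"
    and val: "f a = 1" "f b = 0" "f c = 0" "g a = 0" "g b = 1" "g c = 0" "h a = 0" "h b = 0" "h c = 1"
    and coords: "\<And>x k l m. x = k *\<^sub>R a + l *\<^sub>R b + m *\<^sub>R c \<longleftrightarrow> k = f x \<and> l = g x \<and> m = h x"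
    by (rule triple_coordinates [OF assms]) (rule that)
  define t where "t = sgn ` (convex hull {a, b, c})"
  have t: "t = {x \<in> S2. 0 \<le> f x \<and> 0 \<le> g x \<and> 0 \<le> h x}"
    unfolding t_def sgn_hull_eq_cone [OF zero_notin_hull_triple [OF assms]] coords by simp
  have R: "?R = {x \<in> S2. 0 < f x \<and> 0 < g x \<and> 0 < h x}"
    unfolding coords by simp
  have cont: "continuous_on UNIV f" "continuous_on UNIV g" "continuous_on UNIV h"
    using lin by (simp_all add: linear_continuous_on linear_linear)
  have "open {x. 0 < f x \<and> 0 < g x \<and> 0 < h x}"
    using cont by (intro open_Collect_conj open_Collect_less) auto
  then have "openin (top_of_set S2) ?R"
    unfolding R by (auto simp: openin_open)
  moreover have "?R \<subseteq> t"
    unfolding R t by auto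
  ultimately have 1: "?R \<subseteq> top_of_set S2 interior_of t"
    by (simp add: interior_of_maximal)
  \<comment> \<open>A point of the triangle with a vanishing coordinate leaves the triangle when that
    coordinate is decreased.\<close>
  have push: "0 < \<phi> x" if x: "x \<in> top_of_set S2 interior_of t" and \<phi>: "linear \<phi>" "\<And>y. y \<in> t \<Longrightarrow> 0 \<le> \<phi> y" "\<phi> v = 1"
    for \<phi> :: "real^3 \<Rightarrow> real" and x v
  proof (rule ccontr)
    assume "\<not> 0 < \<phi> x"
    have xt: "x \<in> t"
      using x interior_of_subset [of _ t] by (rule rev_subsetD)
    then have x0: "\<phi> x = 0" "norm x = 1"
      using \<phi>(2) [OF xt] \<open>\<not> 0 < \<phi> x\<close> t by auto
    obtain U where U: "open U" "top_of_set S2 interior_of t = S2 \<inter> U"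
      by (metis openin_interior_of openin_open)
    define y where "y e = sgn (x - e *\<^sub>R v)" for e
    have "isCont y 0"
      unfolding y_def using x0(2) by (intro continuous_intros) auto
    moreover have "y 0 \<in> U"
      using x U(2) x0(2) by (auto simp: y_def sgn_div_norm)
    ultimately have "\<forall>\<^sub>F e in at 0. y e \<in> U"
      using U(1) unfolding isCont_def by (auto dest: topological_tendstoD)
    then obtain d where d: "d > 0" "\<And>e. e \<noteq> 0 \<Longrightarrow> dist e 0 < d \<Longrightarrow> y e \<in> U"
      unfolding eventually_at by auto
    define e where "e = d/2"
    have "e > 0" "y e \<in> U"
      using d by (auto simp: e_def)
    have neg: "\<phi> (x - e *\<^sub>R v) = - e"
      using \<phi> x0 by (simp add: linear_diff linear_scale)
    then have nz: "x - e *\<^sub>R v \<noteq> 0"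
      using \<open>e > 0\<close> linear_0 [OF \<phi>(1)] by auto
    then have "y e \<in> S2"
      by (simp add: y_def norm_sgn)
    then have "y e \<in> t"
      using \<open>y e \<in> U\<close> U(2) interior_of_subset [of "top_of_set S2" t] by auto
    then have "0 \<le> \<phi> (y e)"
      by (rule \<phi>(2))
    moreover have "\<phi> (y e) = - e / norm (x - e *\<^sub>R v)"
      using \<phi>(1) neg by (simp add: y_def sgn_div_norm linear_scale divide_inverse)
    moreover have "- e / norm (x - e *\<^sub>R v) < 0"
      using \<open>e > 0\<close> nz by (simp add: divide_neg_pos)
    ultimately show False
      by linarith
  qed
  have "top_of_set S2 interior_of t \<subseteq> ?R"
    unfolding R
  proof clarify
    fix x assume x: "x \<in> top_of_set S2 interior_of t"
    have "x \<in> S2"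
      using x interior_of_subset [of "top_of_set S2" t] by (auto simp: t)
    moreover have "0 < f x" "0 < g x" "0 < h x"
      using push [OF x lin(1) _ val(1)] push [OF x lin(2) _ val(5)] push [OF x lin(3) _ val(9)] t by auto
    ultimately show "x \<in> S2 \<and> 0 < f x \<and> 0 < g x \<and> 0 < h x"
      by blast
  qed
  with 1 show ?thesis
    unfolding t_def by blast
qed

text \<open>Radial projection is injective on the plane triangle, which is a disc because it is a compact
convex set of dimension two. The boundary arcs are the places where a coordinate vanishes.\<close>

lemma spherical_polygon_triangle:
  fixes a b c :: "real^3"
  assumes abc: "a \<in> S2" "b \<in> S2" "c \<in> S2" and card: "card {a, b, c} = 3" and ind: "independent {a, b, c}"
  shows "spherical_polygon (sgn ` (convex hull {a, b, c}))"
proof -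
  obtain f g h :: "real^3 \<Rightarrow> real" where lin: "linear f" "linear g" "linear h"
    and val: "f a = 1" "f b = 0" "f c = 0" "g a = 0" "g b = 1" "g c = 0" "h a = 0" "h b = 0" "h c = 1"
    and coords: "\<And>x k l m. x = k *\<^sub>R a + l *\<^sub>R b + m *\<^sub>R c \<longleftrightarrow> k = f x \<and> l = g x \<and> m = h x"
    by (rule triple_coordinates [OF card ind]) (rule that)
  let ?H = "convex hull {a, b, c}"
  define t where "t = sgn ` ?H"
  have nz: "0 \<notin> ?H"
    by (rule zero_notin_hull_triple [OF card ind])
  have t: "t = {x \<in> S2. 0 \<le> f x \<and> 0 \<le> g x \<and> 0 \<le> h x}"
    unfolding t_def sgn_hull_eq_cone [OF nz] coords by simp
  have int: "top_of_set S2 interior_of t = {x \<in> S2. 0 < f x \<and> 0 < g x \<and> 0 < h x}"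
    unfolding t_def sgn_hull_triple_interior [OF card ind] coords by simp
  have cont: "continuous_on UNIV f" "continuous_on UNIV g" "continuous_on UNIV h"
    using lin by (simp_all add: linear_continuous_on linear_linear)
  \<comment> \<open>The plane triangle lies in the affine plane on which the coordinates add up to 1,
    so that each ray from the origin meets it at most once.\<close>
  have plane: "f y + g y + h y = 1" if "y \<in> ?H" for y
    using that unfolding convex_hull_3 coords by auto
  have "inj_on sgn ?H"
  proof (rule inj_onI)
    fix y z assume yz: "y \<in> ?H" "z \<in> ?H" "sgn y = sgn z"
    then have "y \<noteq> 0" "z \<noteq> 0"
      using nz by auto
    have "y = norm y *\<^sub>R sgn y"
      using \<open>y \<noteq> 0\<close> by (simp add: sgn_div_norm)
    then have "y = norm y *\<^sub>R sgn z"
      by (simp only: yz(3))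
    then have y: "y = (norm y / norm z) *\<^sub>R z"
      by (simp add: sgn_div_norm divide_inverse)
    have "f ((norm y / norm z) *\<^sub>R z) + g ((norm y / norm z) *\<^sub>R z) + h ((norm y / norm z) *\<^sub>R z)
        = (norm y / norm z) * (f z + g z + h z)"
      using lin by (simp add: linear_scale distrib_left)
    then have "norm y / norm z = 1"
      using plane [OF yz(1)] plane [OF yz(2)] by (simp only: y [symmetric] mult_1_right)
    then show "y = z"
      using y by (simp only: scaleR_one)
  qed
  moreover have "continuous_on ?H sgn"
    using nz by (intro continuous_intros) auto
  moreover have "compact ?H"
    by (simp add: compact_convex_hull finite_imp_compact)
  ultimately have "?H homeomorphic t"
    unfolding t_def by (metis homeomorphic_compact)
  moreover have "?H homeomorphic cball (0::real^2) 1"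
  proof (rule homeomorphic_convex_compact_sets)
    have "\<not> affine_dependent {a, b, c}"
      using ind affine_dependent_imp_dependent by blast
    then have "aff_dim {a, b, c} = int (card {a, b, c}) - 1"
      by (simp add: aff_dim_affine_independent)
    then show "aff_dim ?H = aff_dim (cball (0::real^2) 1)"
      using card by (simp add: aff_dim_convex_hull aff_dim_cball)
  qed (auto simp: compact_convex_hull finite_imp_compact)
  ultimately have hom: "t homeomorphic cball (0::real^2) 1"
    using homeomorphic_sym homeomorphic_trans by blast
  have "{x \<in> S2. 0 \<le> f x \<and> 0 \<le> g x \<and> 0 \<le> h x} = S2 \<inter> {x. 0 \<le> f x \<and> 0 \<le> g x \<and> 0 \<le> h x}"
    by auto
  moreover have "closed {x. 0 \<le> f x \<and> 0 \<le> g x \<and> 0 \<le> h x}"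
    using cont by (intro closed_Collect_conj closed_Collect_le) auto
  ultimately have "closedin (top_of_set S2) t"
    unfolding t by (simp add: closedin_closed_Int)
  then have fr: "top_of_set S2 frontier_of t = t - top_of_set S2 interior_of t"
    by (simp add: frontier_of_def closure_of_closedin)
  have ne: "a \<noteq> b" "b \<noteq> c" "a \<noteq> c"
    using card by (auto simp: card_insert_if split: if_splits)
  have arc: "geodesic_arc (sgn ` closed_segment u v)" if "u \<in> {a, b, c}" "v \<in> {a, b, c}" "u \<noteq> v" for u v
  proof -
    have neg: "f (- a) = - f a" "f (- b) = - f b" "f (- c) = - f c" "g (- a) = - g a" "g (- b) = - g b"
         "g (- c) = - g c" "h (- a) = - h a" "h (- b) = - h b" "h (- c) = - h c"
      using lin by (simp_all add: linear_neg)
    have "u \<noteq> - v"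
    proof
      assume "u = - v"
      then have "f u = f (- v)" "g u = g (- v)" "h u = h (- v)"
        by simp_all
      then show False
        using that val neg by auto
    qed
    then show ?thesis
      using that abc unfolding geodesic_arc_def by blast
  qed
  have edge: "sgn ` closed_segment u v = {x \<in> S2. \<exists>k l. 0 \<le> k \<and> 0 \<le> l \<and> x = k *\<^sub>R u + l *\<^sub>R v}"
    if "u \<in> {a, b, c}" "v \<in> {a, b, c}" for u v
  proof -
    have "0 \<notin> convex hull {u, v, v}"
      using nz that hull_mono [of "{u, v, v}" "{a, b, c}" convex] by blast
    then have "sgn ` (convex hull {u, v, v}) =
        {x \<in> S2. \<exists>k l m. 0 \<le> k \<and> 0 \<le> l \<and> 0 \<le> m \<and> x = k *\<^sub>R u + l *\<^sub>R v + m *\<^sub>R v}"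
      by (rule sgn_hull_eq_cone)
    moreover have "(\<exists>k l m. 0 \<le> k \<and> 0 \<le> l \<and> 0 \<le> m \<and> x = k *\<^sub>R u + l *\<^sub>R v + m *\<^sub>R v) \<longleftrightarrow>
        (\<exists>k l. 0 \<le> k \<and> 0 \<le> l \<and> x = k *\<^sub>R u + l *\<^sub>R v)" for x
    proof
      assume "\<exists>k l m. 0 \<le> k \<and> 0 \<le> l \<and> 0 \<le> m \<and> x = k *\<^sub>R u + l *\<^sub>R v + m *\<^sub>R v"
      then obtain k l m where "0 \<le> k" "0 \<le> l" "0 \<le> m" "x = k *\<^sub>R u + l *\<^sub>R v + m *\<^sub>R v"
        by blast
      then have "0 \<le> k \<and> 0 \<le> l + m \<and> x = k *\<^sub>R u + (l + m) *\<^sub>R v"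
        by (simp add: scaleR_add_left add.assoc)
      then show "\<exists>k l. 0 \<le> k \<and> 0 \<le> l \<and> x = k *\<^sub>R u + l *\<^sub>R v"
        by blast
    next
      assume "\<exists>k l. 0 \<le> k \<and> 0 \<le> l \<and> x = k *\<^sub>R u + l *\<^sub>R v"
      then obtain k l where "0 \<le> k" "0 \<le> l" "x = k *\<^sub>R u + l *\<^sub>R v + 0 *\<^sub>R v"
        by auto
      then show "\<exists>k l m. 0 \<le> k \<and> 0 \<le> l \<and> 0 \<le> m \<and> x = k *\<^sub>R u + l *\<^sub>R v + m *\<^sub>R v"
        by blast
    qed
    ultimately show ?thesis
      by (simp add: segment_convex_hull)
  qed
  have ab: "sgn ` closed_segment a b = {x \<in> t. h x = 0}"
    unfolding edge [of a b, simplified] t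
    using coords [of _ _ _ 0, simplified] by auto
  have bc: "sgn ` closed_segment b c = {x \<in> t. f x = 0}"
    unfolding edge [of b c, simplified] t
    using coords [of _ 0, simplified] by auto
  have ac: "sgn ` closed_segment a c = {x \<in> t. g x = 0}"
    unfolding edge [of a c, simplified] t
    using coords [of _ _ 0, simplified] by auto
  have "top_of_set S2 frontier_of t = \<Union>{sgn ` closed_segment a b, sgn ` closed_segment b c, sgn ` closed_segment a c}"
    unfolding fr ab bc ac int by (auto simp: t)
  moreover have "\<forall>s\<in>{sgn ` closed_segment a b, sgn ` closed_segment b c, sgn ` closed_segment a c}. geodesic_arc s"
    using arc ne by auto
  ultimately have "\<exists>A. finite A \<and> (\<forall>s\<in>A. geodesic_arc s) \<and> top_of_set S2 frontier_of t = \<Union>A"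
    by (meson finite.emptyI finite.insertI)
  moreover have "t \<subseteq> S2"
    by (auto simp: t)
  ultimately show ?thesis
    using hom unfolding spherical_polygon_def t_def by blast
qed

section \<open>Right-angled triples of unit vectors\<close>

text \<open>The vertices of a spherical triangle with a right angle at \<open>b\<close> whose legs have cosines \<open>x\<close>
and \<open>z\<close>. The value \<open>x * z\<close> for the hypotenuse is the spherical theorem of Pythagoras.\<close>

definition right_triple :: "real \<Rightarrow> real \<Rightarrow> real^3 \<Rightarrow> real^3 \<Rightarrow> real^3 \<Rightarrow> bool"
  where "right_triple x z a b c \<longleftrightarrow>
    norm a = 1 \<and> norm b = 1 \<and> norm c = 1 \<and> a \<bullet> b = x \<and> b \<bullet> c = z \<and> a \<bullet> c = x * z"

lemma right_triple_rev: "right_triple x z a b c \<Longrightarrow> right_triple z x c b a"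
  by (auto simp: right_triple_def inner_commute mult.commute)

lemma right_triple_basis:
  assumes "0 < x" "x < 1" "0 < z" "z < 1" and rt: "right_triple x z a b c"
  shows "card {a, b, c} = 3" "independent {a, b, c}"
proof -
  have sq: "x\<^sup>2 < 1" "z\<^sup>2 < 1"
    using assms by (simp_all add: power_less_one_iff)
  have g: "a \<bullet> a = 1" "b \<bullet> b = 1" "c \<bullet> c = 1" "a \<bullet> b = x" "b \<bullet> c = z" "a \<bullet> c = x * z"
    "b \<bullet> a = x" "c \<bullet> b = z" "c \<bullet> a = x * z"
    using rt by (auto simp: right_triple_def inner_commute norm_eq_1)
  have "k = 0 \<and> l = 0 \<and> m = 0" if *: "k *\<^sub>R a + l *\<^sub>R b + m *\<^sub>R c = 0" for k l m
  proof -
    have "(k *\<^sub>R a + l *\<^sub>R b + m *\<^sub>R c) \<bullet> (a - x *\<^sub>R b) = k * (1 - x\<^sup>2)"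
      by (simp add: inner_diff_right inner_add_left g algebra_simps power2_eq_square)
    then have "k = 0"
      unfolding * using sq by simp
    have "(k *\<^sub>R a + l *\<^sub>R b + m *\<^sub>R c) \<bullet> (c - z *\<^sub>R b) = m * (1 - z\<^sup>2)"
      by (simp add: inner_diff_right inner_add_left g algebra_simps power2_eq_square)
    then have "m = 0"
      unfolding * using sq by simp
    have "l *\<^sub>R b = 0"
      using * \<open>k = 0\<close> \<open>m = 0\<close> by simp
    then have "l = 0"
      using g(2) by auto
    with \<open>k = 0\<close> \<open>m = 0\<close> show ?thesis
      by simp
  qed
  then show "card {a, b, c} = 3" "independent {a, b, c}"
    by (rule independent_tripleI; blast)+
qed

text \<open>Inner products are determined by coordinates and the Gram matrix of the basis, so that the
map which preserves coordinates preserves them.\<close>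

lemma congruent_bases_orthogonal_transformation:
  fixes a b c a' b' c' :: "real^3"
  assumes "card {a, b, c} = 3" "independent {a, b, c}"
    and gram: "a \<bullet> a = a' \<bullet> a'" "b \<bullet> b = b' \<bullet> b'" "c \<bullet> c = c' \<bullet> c'"
      "a \<bullet> b = a' \<bullet> b'" "b \<bullet> c = b' \<bullet> c'" "a \<bullet> c = a' \<bullet> c'"
  obtains T where "orthogonal_transformation T" "T a = a'" "T b = b'" "T c = c'"
proof -
  obtain f g h :: "real^3 \<Rightarrow> real" where lin: "linear f" "linear g" "linear h"
    and val: "f a = 1" "f b = 0" "f c = 0" "g a = 0" "g b = 1" "g c = 0" "h a = 0" "h b = 0" "h c = 1"
    and coords: "\<And>x k l m. x = k *\<^sub>R a + l *\<^sub>R b + m *\<^sub>R c \<longleftrightarrow> k = f x \<and> l = g x \<and> m = h x"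
    by (rule triple_coordinates [OF assms(1,2)]) (rule that)
  define T where "T y = f y *\<^sub>R a' + g y *\<^sub>R b' + h y *\<^sub>R c'" for y
  have gram': "b \<bullet> a = b' \<bullet> a'" "c \<bullet> b = c' \<bullet> b'" "c \<bullet> a = c' \<bullet> a'"
    using gram(4-6) by (simp_all only: inner_commute)
  have "linear T"
    unfolding T_def using lin
    by (simp add: linear_iff algebra_simps)
  moreover have "T y \<bullet> T w = y \<bullet> w" for y w
  proof -
    have y: "y = f y *\<^sub>R a + g y *\<^sub>R b + h y *\<^sub>R c" and w: "w = f w *\<^sub>R a + g w *\<^sub>R b + h w *\<^sub>R c"
      using coords by blast+
    have "T y \<bullet> T w = (f y *\<^sub>R a + g y *\<^sub>R b + h y *\<^sub>R c) \<bullet> (f w *\<^sub>R a + g w *\<^sub>R b + h w *\<^sub>R c)"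
      unfolding T_def by (simp add: inner_add_left inner_add_right gram gram')
    then show ?thesis
      using y w by simp
  qed
  ultimately have "orthogonal_transformation T"
    unfolding orthogonal_transformation_def by blast
  moreover have "T a = a'" "T b = b'" "T c = c'"
    by (simp_all add: T_def val)
  ultimately show thesis
    by (rule that)
qed

text \<open>A vector with prescribed norm and prescribed inner products with \<open>u\<close> and \<open>w\<close> lies on a sphere
and on a line parallel to \<open>cross3 u w\<close>, which leaves at most two possibilities: \<open>x\<close> and its
mirror image in the plane of \<open>u\<close> and \<open>w\<close>.\<close>

lemma mirror_image_unique:
  fixes u w x y z :: "real^3"
  assumes uw: "cross3 u w \<noteq> 0"
    and norms: "norm y = norm x" "norm z = norm x"
    and ips: "y \<bullet> u = x \<bullet> u" "z \<bullet> u = x \<bullet> u" "y \<bullet> w = x \<bullet> w" "z \<bullet> w = x \<bullet> w"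
    and ne: "y \<noteq> x" "z \<noteq> x"
  shows "y = z"
proof -
  define n where "n = cross3 u w"
  have line: "\<exists>t. d = t *\<^sub>R n" if "d \<bullet> u = 0" "d \<bullet> w = 0" for d
  proof -
    have "cross3 n d = 0"
      unfolding n_def using that Lagrange [of d u w] cross_skew [of "cross3 u w" d]
      by (simp add: inner_commute)
    then have "collinear {0, n, d}"
      by (simp add: cross_eq_0)
    then show ?thesis
      using uw by (auto simp: collinear_lemma n_def)
  qed
  obtain s t where s: "y - x = s *\<^sub>R n" and t: "z - x = t *\<^sub>R n"
    using line [of "y - x"] line [of "z - x"] ips by (auto simp: inner_diff_left)
  have root: "r = - (2 * (x \<bullet> n) / (n \<bullet> n))" if "norm (x + r *\<^sub>R n) = norm x" "r \<noteq> 0" for r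
  proof -
    have "(x + r *\<^sub>R n) \<bullet> (x + r *\<^sub>R n) = x \<bullet> x"
      using that(1) by (simp add: norm_eq)
    then have "r * (2 * (x \<bullet> n) + r * (n \<bullet> n)) = 0"
      by (simp add: inner_add_left inner_add_right inner_commute algebra_simps)
    then have "2 * (x \<bullet> n) + r * (n \<bullet> n) = 0"
      using that(2) by simp
    moreover have "n \<bullet> n \<noteq> 0"
      using uw by (simp add: n_def)
    ultimately show ?thesis
      by (simp add: field_simps)
  qed
  have y: "y = x + s *\<^sub>R n" and z: "z = x + t *\<^sub>R n"
    using s t by (simp_all add: algebra_simps)
  have "s \<noteq> 0" "t \<noteq> 0"
    using ne y z by auto
  then have "s = t"
    using root [of s] root [of t] norms y z by simp
  then show ?thesis
    using y z by simp
qed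

lemma cross_unit_nonzero:
  fixes u w :: "real^3"
  assumes "norm u = 1" "norm w = 1" "\<bar>u \<bullet> w\<bar> < 1"
  shows "cross3 u w \<noteq> 0"
proof
  assume "cross3 u w = 0"
  then have "(u \<bullet> w)\<^sup>2 = 1"
    using norm_and_cross_eq_0 norm_cross [of u w] assms by simp
  then show False
    using assms(3) by (simp add: power2_eq_1_iff) linarith
qed

lemma right_triple_cross:
  assumes "0 < x" "x < 1" "0 < z" "z < 1" and rt: "right_triple x z a b c"
  shows "cross3 b c \<noteq> 0" "cross3 a c \<noteq> 0" "cross3 a b \<noteq> 0"
proof -
  have "0 < x * z" "x * z < 1"
    using assms mult_strict_mono [of x 1 z 1] by auto
  then show "cross3 b c \<noteq> 0" "cross3 a c \<noteq> 0" "cross3 a b \<noteq> 0"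
    using assms unfolding right_triple_def by (intro cross_unit_nonzero; simp)+
qed

subsection \<open>Angles\<close>

lemma sph_angle_commute: "sph_angle A B C = sph_angle C B A"
  by (simp add: sph_angle_def Let_def inner_commute mult.commute)

lemma right_triple_right_angle:
  assumes "right_triple x z a b c"
  shows "sph_angle a b c = pi/2"
proof -
  have g: "b \<bullet> b = 1" "a \<bullet> b = x" "b \<bullet> c = z" "a \<bullet> c = x * z" "c \<bullet> b = z"
    using assms by (auto simp: right_triple_def inner_commute norm_eq_1)
  have "(a - x *\<^sub>R b) \<bullet> (c - z *\<^sub>R b) = 0"
    by (simp add: inner_diff_left inner_diff_right g algebra_simps)
  then show ?thesis
    by (simp add: sph_angle_def g Let_def)
qed

lemma right_triple_tangents:
  assumes "0 < x" "x < 1" "0 < z" "z < 1" and "right_triple x z a b c"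
  shows "(b - x *\<^sub>R a) \<bullet> (c - (x * z) *\<^sub>R a) = z * (1 - x\<^sup>2)"
    "norm (b - x *\<^sub>R a) = sqrt (1 - x\<^sup>2)"
    "norm (c - (x * z) *\<^sub>R a) = sqrt (1 - x\<^sup>2 * z\<^sup>2)"
proof -
  have g: "a \<bullet> a = 1" "b \<bullet> b = 1" "c \<bullet> c = 1" "a \<bullet> b = x" "b \<bullet> c = z" "a \<bullet> c = x * z"
    "b \<bullet> a = x" "c \<bullet> b = z" "c \<bullet> a = x * z"
    using assms by (auto simp: right_triple_def inner_commute norm_eq_1)
  show "(b - x *\<^sub>R a) \<bullet> (c - (x * z) *\<^sub>R a) = z * (1 - x\<^sup>2)"
    "norm (b - x *\<^sub>R a) = sqrt (1 - x\<^sup>2)"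
    "norm (c - (x * z) *\<^sub>R a) = sqrt (1 - x\<^sup>2 * z\<^sup>2)"
    unfolding norm_eq_sqrt_inner
    by (simp_all add: inner_diff_left inner_diff_right g algebra_simps power2_eq_square)
qed

text \<open>The angle at \<open>a\<close> of a right triple, given by Napier's rules.\<close>

definition right_angle_at :: "real \<Rightarrow> real \<Rightarrow> real"
  where "right_angle_at x z = arccos (z * sqrt (1 - x\<^sup>2) / sqrt (1 - x\<^sup>2 * z\<^sup>2))"

lemma right_triple_angle:
  assumes "0 < x" "x < 1" "0 < z" "z < 1" and rt: "right_triple x z a b c"
  shows "sph_angle b a c = right_angle_at x z"
proof -
  have "0 < 1 - x\<^sup>2"
    using assms by (simp add: power_less_one_iff)
  then have "(1 - x\<^sup>2) / sqrt (1 - x\<^sup>2) = sqrt (1 - x\<^sup>2)"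
    by (simp add: real_div_sqrt)
  then have "z * (1 - x\<^sup>2) / (sqrt (1 - x\<^sup>2) * sqrt (1 - x\<^sup>2 * z\<^sup>2))
      = z * sqrt (1 - x\<^sup>2) / sqrt (1 - x\<^sup>2 * z\<^sup>2)"
    by (metis (no_types, opaque_lifting) divide_divide_eq_left times_divide_eq_right)
  moreover have "b \<bullet> a = x" "c \<bullet> a = x * z"
    using rt by (simp_all add: right_triple_def inner_commute)
  ultimately show ?thesis
    using right_triple_tangents [OF assms]
    by (simp add: sph_angle_def right_angle_at_def Let_def)
qed

lemma right_angle_at_bounds:
  assumes "0 < x" "x < 1" "0 < z" "z < 1"
  shows "cos (right_angle_at x z) = z * sqrt (1 - x\<^sup>2) / sqrt (1 - x\<^sup>2 * z\<^sup>2)"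
    "sin (right_angle_at x z) = sqrt (1 - z\<^sup>2) / sqrt (1 - x\<^sup>2 * z\<^sup>2)"
    "0 < right_angle_at x z" "right_angle_at x z < pi/2"
proof -
  let ?c = "z * sqrt (1 - x\<^sup>2) / sqrt (1 - x\<^sup>2 * z\<^sup>2)"
  have sq: "0 < 1 - x\<^sup>2" "0 < 1 - z\<^sup>2" "0 < x\<^sup>2" "0 < z\<^sup>2"
    using assms by (simp_all add: power_less_one_iff)
  have "x\<^sup>2 * z\<^sup>2 < 1 * 1"
    using sq by (intro mult_strict_mono) auto
  then have D: "0 < 1 - x\<^sup>2 * z\<^sup>2"
    by simp
  have c2: "?c\<^sup>2 = z\<^sup>2 * (1 - x\<^sup>2) / (1 - x\<^sup>2 * z\<^sup>2)"
    using sq D by (simp add: power_divide power_mult_distrib)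
  have "1 - z\<^sup>2 * (1 - x\<^sup>2) / (1 - x\<^sup>2 * z\<^sup>2) = (1 - z\<^sup>2) / (1 - x\<^sup>2 * z\<^sup>2)"
    using D by (simp add: field_simps)
  then have s2: "1 - ?c\<^sup>2 = (1 - z\<^sup>2) / (1 - x\<^sup>2 * z\<^sup>2)"
    unfolding c2 .
  have pos: "0 < ?c"
    using assms sq D by simp
  have "0 < 1 - ?c\<^sup>2"
    unfolding s2 using sq D by simp
  then have "?c < 1"
    using pos by (simp add: power2_less_1_iff abs_square_less_1)
  then have ran: "-1 \<le> ?c" "?c \<le> 1"
    using pos by linarith+
  show "cos (right_angle_at x z) = ?c"
    unfolding right_angle_at_def using ran by (rule cos_arccos)
  have "sin (right_angle_at x z) = sqrt (1 - ?c\<^sup>2)"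
    unfolding right_angle_at_def using ran by (rule sin_arccos)
  then show "sin (right_angle_at x z) = sqrt (1 - z\<^sup>2) / sqrt (1 - x\<^sup>2 * z\<^sup>2)"
    unfolding s2 by (simp add: real_sqrt_divide)
  show "0 < right_angle_at x z"
    unfolding right_angle_at_def using arccos_less_arccos [of ?c 1] ran \<open>?c < 1\<close> by simp
  show "right_angle_at x z < pi/2"
    unfolding right_angle_at_def using arccos_less_arccos [of 0 ?c] ran pos by simp
qed

text \<open>A right-angled spherical triangle is determined by its two other angles, by the rule of Napier
that expresses a leg through them.\<close>

lemma sides_from_angles:
  assumes "0 < x" "x < 1" "0 < z" "z < 1"
  shows "x = cos (right_angle_at z x) / sin (right_angle_at x z)"
proof -
  have sq: "0 < 1 - x\<^sup>2" "0 < 1 - z\<^sup>2" "0 < x\<^sup>2" "0 < z\<^sup>2"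
    using assms by (simp_all add: power_less_one_iff)
  have "x\<^sup>2 * z\<^sup>2 < 1 * 1"
    using sq by (intro mult_strict_mono) auto
  then have "0 < sqrt (1 - x\<^sup>2 * z\<^sup>2)" "0 < sqrt (1 - z\<^sup>2)"
    using sq by simp_all
  then show ?thesis
    unfolding right_angle_at_bounds(1) [OF assms(3,4,1,2)] right_angle_at_bounds(2) [OF assms]
    by (simp add: mult.commute [of "z\<^sup>2"])
qed

section \<open>Chamber systems\<close>

type_synonym chamber = "(real^3) \<times> (real^3) \<times> (real^3)"

definition closed_under_adjacency :: "chamber set \<Rightarrow> chamber set \<Rightarrow> bool"
  where "closed_under_adjacency \<Phi> R \<longleftrightarrow>
    (\<forall>a b c d. (a, b, c) \<in> R \<longrightarrow> (d, b, c) \<in> \<Phi> \<longrightarrow> (d, b, c) \<in> R) \<and>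
    (\<forall>a b c d. (a, b, c) \<in> R \<longrightarrow> (a, d, c) \<in> \<Phi> \<longrightarrow> (a, d, c) \<in> R) \<and>
    (\<forall>a b c d. (a, b, c) \<in> R \<longrightarrow> (a, b, d) \<in> \<Phi> \<longrightarrow> (a, b, d) \<in> R)"

text \<open>What the flags of a regular solid look like without the solid: congruent right triples, such
that every entry of a triple can be exchanged for another one and any two triples are joined
by such exchanges. The notion is invariant under reversal of the triples, which interchanges
the roles of vertices and faces and thus accounts for duality.\<close>

definition chamber_system :: "real \<Rightarrow> real \<Rightarrow> chamber set \<Rightarrow> bool"
  where "chamber_system x z \<Phi> \<longleftrightarrow>
    0 < x \<and> x < 1 \<and> 0 < z \<and> z < 1 \<and> \<Phi> \<noteq> {} \<and>
    (\<forall>a b c. (a, b, c) \<in> \<Phi> \<longrightarrow> right_triple x z a b c) \<and>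
    (\<forall>a b c. (a, b, c) \<in> \<Phi> \<longrightarrow>
      (\<exists>a'. a' \<noteq> a \<and> (a', b, c) \<in> \<Phi>) \<and>
      (\<exists>b'. b' \<noteq> b \<and> (a, b', c) \<in> \<Phi>) \<and>
      (\<exists>c'. c' \<noteq> c \<and> (a, b, c') \<in> \<Phi>)) \<and>
    (\<forall>R \<subseteq> \<Phi>. R \<noteq> {} \<longrightarrow> closed_under_adjacency \<Phi> R \<longrightarrow> R = \<Phi>)"

lemma chamber_systemD:
  assumes "chamber_system x z \<Phi>"
  shows "0 < x" "x < 1" "0 < z" "z < 1" "\<Phi> \<noteq> {}"
    and "\<And>a b c. (a, b, c) \<in> \<Phi> \<Longrightarrow> right_triple x z a b c"
    and "\<And>a b c. (a, b, c) \<in> \<Phi> \<Longrightarrow> \<exists>a'. a' \<noteq> a \<and> (a', b, c) \<in> \<Phi>"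
    and "\<And>a b c. (a, b, c) \<in> \<Phi> \<Longrightarrow> \<exists>b'. b' \<noteq> b \<and> (a, b', c) \<in> \<Phi>"
    and "\<And>a b c. (a, b, c) \<in> \<Phi> \<Longrightarrow> \<exists>c'. c' \<noteq> c \<and> (a, b, c') \<in> \<Phi>"
  using assms unfolding chamber_system_def by blast+

lemma chamber_system_connected:
  assumes "chamber_system x z \<Phi>" "R \<subseteq> \<Phi>" "R \<noteq> {}" "closed_under_adjacency \<Phi> R"
  shows "R = \<Phi>"
  using assms unfolding chamber_system_def by blast

definition map_chamber :: "(real^3 \<Rightarrow> real^3) \<Rightarrow> chamber \<Rightarrow> chamber"
  where "map_chamber T = (\<lambda>(a, b, c). (T a, T b, T c))"

definition rev_chamber :: "chamber \<Rightarrow> chamber"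
  where "rev_chamber = (\<lambda>(a, b, c). (c, b, a))"

definition triangle_of :: "chamber \<Rightarrow> (real^3) set"
  where "triangle_of = (\<lambda>(a, b, c). sgn ` (convex hull {a, b, c}))"

lemma map_chamber_simp [simp]: "map_chamber T (a, b, c) = (T a, T b, T c)"
  by (simp add: map_chamber_def)

lemma rev_chamber_simp [simp]: "rev_chamber (a, b, c) = (c, b, a)"
  by (simp add: rev_chamber_def)

lemma mem_rev_chamber_image [simp]: "(a, b, c) \<in> rev_chamber ` \<Phi> \<longleftrightarrow> (c, b, a) \<in> \<Phi>"
  by (force simp: image_iff rev_chamber_def)

lemma rev_chamber_image_image [simp]: "rev_chamber ` rev_chamber ` \<Phi> = \<Phi>"
proof -
  have "rev_chamber (rev_chamber \<phi>) = \<phi>" for \<phi>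
    by (cases \<phi>) simp
  then show ?thesis
    by (simp add: image_image)
qed

lemma chamber_system_rev:
  assumes "chamber_system x z \<Phi>"
  shows "chamber_system z x (rev_chamber ` \<Phi>)"
proof -
  have conn: "R = rev_chamber ` \<Phi>"
    if R: "R \<subseteq> rev_chamber ` \<Phi>" "R \<noteq> {}" "closed_under_adjacency (rev_chamber ` \<Phi>) R" for R
  proof -
    have "rev_chamber ` R \<subseteq> \<Phi>"
      using image_mono [OF R(1), of rev_chamber] by simp
    moreover have "closed_under_adjacency \<Phi> (rev_chamber ` R)"
      using R(3) unfolding closed_under_adjacency_def mem_rev_chamber_image by metis
    ultimately have "rev_chamber ` R = \<Phi>"
      using chamber_system_connected [OF assms] R(2) by simp
    then show ?thesis
      using rev_chamber_image_image [of R] by simp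
  qed
  show ?thesis
    unfolding chamber_system_def
  proof (intro conjI)
    show "\<forall>a b c. (a, b, c) \<in> rev_chamber ` \<Phi> \<longrightarrow> right_triple z x a b c"
      using chamber_systemD(6) [OF assms] by (simp add: right_triple_rev)
    show "\<forall>a b c. (a, b, c) \<in> rev_chamber ` \<Phi> \<longrightarrow>
      (\<exists>a'. a' \<noteq> a \<and> (a', b, c) \<in> rev_chamber ` \<Phi>) \<and>
      (\<exists>b'. b' \<noteq> b \<and> (a, b', c) \<in> rev_chamber ` \<Phi>) \<and>
      (\<exists>c'. c' \<noteq> c \<and> (a, b, c') \<in> rev_chamber ` \<Phi>)"
      using chamber_systemD(7-9) [OF assms] by simp
  qed (use chamber_systemD(1-5) [OF assms] conn in simp_all)
qed

lemma triangle_of_rev [simp]: "triangle_of (rev_chamber \<phi>) = triangle_of \<phi>"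
  by (cases \<phi>) (simp add: triangle_of_def insert_commute)

lemma triangle_of_rev_image: "triangle_of ` rev_chamber ` \<Phi> = triangle_of ` \<Phi>"
  by (simp add: image_image)

lemma orthogonal_transformation_sgn:
  assumes "orthogonal_transformation T"
  shows "T (sgn x) = sgn (T x)"
  using assms
  by (simp add: sgn_div_norm orthogonal_transformation_norm orthogonal_transformation_scaleR)

lemma triangle_of_map:
  assumes "orthogonal_transformation T"
  shows "triangle_of (map_chamber T \<phi>) = T ` triangle_of \<phi>"
proof (cases \<phi>)
  case (fields a b c)
  have "convex hull {T a, T b, T c} = T ` (convex hull {a, b, c})"
    using convex_hull_linear_image [OF orthogonal_transformation_linear [OF assms], of "{a, b, c}"]
    by simp
  then show ?thesis
    by (simp add: fields triangle_of_def image_image orthogonal_transformation_sgn [OF assms])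
qed

lemma triangle_of_map_image:
  assumes "orthogonal_transformation T"
  shows "triangle_of ` map_chamber T ` \<Phi> = (`) T ` triangle_of ` \<Phi>"
  by (simp add: image_image triangle_of_map [OF assms])

lemma orthogonal_transformation_sph_isometry:
  assumes "orthogonal_transformation T"
  shows "sph_isometry T"
  unfolding sph_isometry_def
proof (intro conjI ballI)
  have "inv T y \<in> S2" "T (inv T y) = y" if "y \<in> S2" for y
    using that assms orthogonal_transformation_norm [OF orthogonal_transformation_inv [OF assms]]
    by (auto simp: surj_f_inv_f orthogonal_transformation_surj)
  then show "T ` S2 = S2"
    using orthogonal_transformation_norm [OF assms]
    by (metis (no_types, lifting) image_eqI image_subsetI mem_sphere_0 subsetI subset_antisym)
  show "sph_dist (T x) (T y) = sph_dist x y" for x y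
    using assms by (simp add: sph_dist_def orthogonal_transformation_def)
qed

lemma chamber_map_subset:
  assumes \<Phi>: "chamber_system x z \<Phi>" and \<Psi>: "chamber_system x z \<Psi>"
    and T: "orthogonal_transformation T"
    and \<phi>: "\<phi> \<in> \<Phi>" "map_chamber T \<phi> \<in> \<Psi>"
  shows "map_chamber T ` \<Phi> \<subseteq> \<Psi>"
proof -
  define R where "R = {\<phi> \<in> \<Phi>. map_chamber T \<phi> \<in> \<Psi>}"
  have xz: "0 < x" "x < 1" "0 < z" "z < 1"
    using chamber_systemD(1-4) [OF \<Phi>] by simp_all
  have rt\<Phi>: "right_triple x z a b c" if "(a, b, c) \<in> \<Phi>" for a b c
    using chamber_systemD(6) [OF \<Phi> that] .
  have rt\<Psi>: "right_triple x z a b c" if "(a, b, c) \<in> \<Psi>" for a b c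
    using chamber_systemD(6) [OF \<Psi> that] .
  have rtT: "right_triple x z (T a) (T b) (T c)" if "(a, b, c) \<in> \<Phi>" for a b c
    using rt\<Phi> [OF that] T
    by (simp add: right_triple_def orthogonal_transformation_norm)
       (simp add: orthogonal_transformation_def)
  have inj: "T u \<noteq> T v" if "u \<noteq> v" for u v
    using that orthogonal_transformation_inj [OF T] by (simp add: inj_eq)
  \<comment> \<open>Each position of a chamber admits a single replacement, the mirror image, so that
    the replacement in the first system is mapped to the replacement in the second.\<close>
  have "(d, b, c) \<in> R" if "(a, b, c) \<in> R" "(d, b, c) \<in> \<Phi>" for a b c d
  proof (cases "d = a")
    case False
    have ab: "(a, b, c) \<in> \<Phi>" "(T a, T b, T c) \<in> \<Psi>"
      using that(1) by (auto simp: R_def)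
    then obtain e where e: "e \<noteq> T a" "(e, T b, T c) \<in> \<Psi>"
      using chamber_systemD(7) [OF \<Psi>] by blast
    have "T d = e"
      using mirror_image_unique [of "T b" "T c" "T d" "T a" e] right_triple_cross(1) [OF xz rtT [OF ab(1)]]
        rtT [OF ab(1)] rtT [OF that(2)] rt\<Psi> [OF e(2)] e(1) inj [OF False]
      by (simp add: right_triple_def)
    then show ?thesis
      using e(2) that(2) by (simp add: R_def)
  qed (use that in simp)
  moreover have "(a, d, c) \<in> R" if "(a, b, c) \<in> R" "(a, d, c) \<in> \<Phi>" for a b c d
  proof (cases "d = b")
    case False
    have ab: "(a, b, c) \<in> \<Phi>" "(T a, T b, T c) \<in> \<Psi>"
      using that(1) by (auto simp: R_def)
    then obtain e where e: "e \<noteq> T b" "(T a, e, T c) \<in> \<Psi>"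
      using chamber_systemD(8) [OF \<Psi>] by blast
    have "T d = e"
      using mirror_image_unique [of "T a" "T c" "T d" "T b" e] right_triple_cross(2) [OF xz rtT [OF ab(1)]]
        rtT [OF ab(1)] rtT [OF that(2)] rt\<Psi> [OF e(2)] e(1) inj [OF False]
      by (simp add: right_triple_def inner_commute)
    then show ?thesis
      using e(2) that(2) by (simp add: R_def)
  qed (use that in simp)
  moreover have "(a, b, d) \<in> R" if "(a, b, c) \<in> R" "(a, b, d) \<in> \<Phi>" for a b c d
  proof (cases "d = c")
    case False
    have ab: "(a, b, c) \<in> \<Phi>" "(T a, T b, T c) \<in> \<Psi>"
      using that(1) by (auto simp: R_def)
    then obtain e where e: "e \<noteq> T c" "(T a, T b, e) \<in> \<Psi>"
      using chamber_systemD(9) [OF \<Psi>] by blast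
    have "T d = e"
      using mirror_image_unique [of "T a" "T b" "T d" "T c" e] right_triple_cross(3) [OF xz rtT [OF ab(1)]]
        rtT [OF ab(1)] rtT [OF that(2)] rt\<Psi> [OF e(2)] e(1) inj [OF False]
      by (simp add: right_triple_def inner_commute)
    then show ?thesis
      using e(2) that(2) by (simp add: R_def)
  qed (use that in simp)
  moreover have "\<phi> \<in> R" "R \<subseteq> \<Phi>"
    using \<phi> by (auto simp: R_def)
  ultimately have "R \<subseteq> \<Phi>" "R \<noteq> {}" "closed_under_adjacency \<Phi> R"
    unfolding closed_under_adjacency_def by blast+
  then have "R = \<Phi>"
    by (rule chamber_system_connected [OF \<Phi>])
  then show ?thesis
    unfolding R_def by (metis (mono_tags, lifting) image_subsetI mem_Collect_eq)
qed

text \<open>An exchange in one system is a reflection, and therefore corresponds to the exchange at the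
same position in the other system. Thus a map that matches one pair of chambers matches their
neighbours, and all chambers because the systems are connected.\<close>

theorem chamber_systems_congruent:
  assumes \<Phi>: "chamber_system x z \<Phi>" and \<Psi>: "chamber_system x z \<Psi>"
    and \<phi>: "\<phi> \<in> \<Phi>" and \<psi>: "\<psi> \<in> \<Psi>"
  obtains T where "orthogonal_transformation T" "map_chamber T \<phi> = \<psi>" "map_chamber T ` \<Phi> = \<Psi>"
proof -
  obtain a b c where abc: "\<phi> = (a, b, c)"
    by (cases \<phi>)
  obtain a' b' c' where abc': "\<psi> = (a', b', c')"
    by (cases \<psi>)
  have xz: "0 < x" "x < 1" "0 < z" "z < 1"
    using chamber_systemD(1-4) [OF \<Phi>] by simp_all
  have rt: "right_triple x z a b c" "right_triple x z a' b' c'"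
    using chamber_systemD(6) [OF \<Phi>] chamber_systemD(6) [OF \<Psi>] \<phi> \<psi> by (simp_all add: abc abc')
  obtain T where T: "orthogonal_transformation T" "T a = a'" "T b = b'" "T c = c'"
  proof (rule congruent_bases_orthogonal_transformation [OF right_triple_basis [OF xz rt(1)]])
    show "a \<bullet> a = a' \<bullet> a'" "b \<bullet> b = b' \<bullet> b'" "c \<bullet> c = c' \<bullet> c'"
      "a \<bullet> b = a' \<bullet> b'" "b \<bullet> c = b' \<bullet> c'" "a \<bullet> c = a' \<bullet> c'"
      using rt unfolding right_triple_def norm_eq_1 by metis+
  qed (rule that)
  define U where "U = inv T"
  have U: "orthogonal_transformation U"
    unfolding U_def by (rule orthogonal_transformation_inv [OF T(1)])
  have UT: "T (U y) = y" "U (T y) = y" for y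
    unfolding U_def using T(1)
    by (simp_all add: surj_f_inv_f orthogonal_transformation_surj orthogonal_transformation_inj)
  have m: "map_chamber T \<phi> = \<psi>" "map_chamber U \<psi> = \<phi>"
    using T UT by (auto simp: abc abc')
  have "map_chamber T ` \<Phi> \<subseteq> \<Psi>" "map_chamber U ` \<Psi> \<subseteq> \<Phi>"
    using chamber_map_subset [OF \<Phi> \<Psi> T(1)] chamber_map_subset [OF \<Psi> \<Phi> U] \<phi> \<psi> m by auto
  moreover have "\<Psi> = map_chamber T ` map_chamber U ` \<Psi>"
    using UT by (force simp: image_image map_chamber_def split: prod.splits)
  ultimately have "map_chamber T ` \<Phi> = \<Psi>"
    by blast
  then show thesis
    using T(1) m(1) that by blast
qed

corollary chamber_tiling_symmetric:
  assumes \<Phi>: "chamber_system x z \<Phi>" and "tiling (triangle_of ` \<Phi>)"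
  shows "symmetric_tiling (triangle_of ` \<Phi>)"
  unfolding symmetric_tiling_def
proof (intro conjI ballI)
  fix t \<tau> assume "t \<in> triangle_of ` \<Phi>" "\<tau> \<in> triangle_of ` \<Phi>"
  then obtain \<phi> \<psi> where \<phi>: "\<phi> \<in> \<Phi>" "t = triangle_of \<phi>" and \<psi>: "\<psi> \<in> \<Phi>" "\<tau> = triangle_of \<psi>"
    by auto
  obtain T where T: "orthogonal_transformation T" "map_chamber T \<phi> = \<psi>" "map_chamber T ` \<Phi> = \<Phi>"
    using chamber_systems_congruent [OF \<Phi> \<Phi> \<phi>(1) \<psi>(1)] .
  have "(`) T ` triangle_of ` \<Phi> = triangle_of ` \<Phi>"
    using triangle_of_map_image [OF T(1), of \<Phi>] T(3) by simp
  moreover have "T ` t = \<tau>"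
    using triangle_of_map [OF T(1), of \<phi>] T(2) \<phi>(2) \<psi>(2) by simp
  ultimately show "\<exists>g. sph_isometry g \<and> (`) g ` triangle_of ` \<Phi> = triangle_of ` \<Phi> \<and> g ` t = \<tau>"
    using orthogonal_transformation_sph_isometry [OF T(1)] by blast
qed (fact assms(2))

corollary chamber_tilings_same:
  assumes \<Phi>: "chamber_system x z \<Phi>" and \<Psi>: "chamber_system x z \<Psi>"
  shows "same_up_to_isometry (triangle_of ` \<Phi>) (triangle_of ` \<Psi>)"
proof -
  obtain \<phi> \<psi> where "\<phi> \<in> \<Phi>" "\<psi> \<in> \<Psi>"
    using chamber_systemD(5) [OF \<Phi>] chamber_systemD(5) [OF \<Psi>] by blast
  then obtain T where T: "orthogonal_transformation T" "map_chamber T ` \<Phi> = \<Psi>"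
    using chamber_systems_congruent [OF \<Phi> \<Psi>] by metis
  then show ?thesis
    unfolding same_up_to_isometry_def
    using triangle_of_map_image [OF T(1), of \<Phi>] orthogonal_transformation_sph_isometry [OF T(1)] by metis
qed

section \<open>The angle at a vertex of a chamber\<close>

text \<open>A set of reals which is closed under steps of length \<open>s\<close> and has no element inside a step
contains no nonnegative numbers but the multiples of \<open>s\<close>, once it contains \<open>0\<close>. So a
full circle, which returns to the start, is a whole number of steps.\<close>

lemma progression_count:
  fixes A :: "real set"
  assumes s: "0 < s" and L: "0 < L" "L \<in> A" and zero: "0 \<in> A"
    and step: "\<And>\<theta>. \<theta> \<in> A \<Longrightarrow> \<theta> + s \<in> A"
    and gap: "\<And>\<theta> \<psi>. \<theta> \<in> A \<Longrightarrow> \<theta> < \<psi> \<Longrightarrow> \<psi> < \<theta> + s \<Longrightarrow> \<psi> \<notin> A"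
  obtains k where "L = real k * s" "A \<inter> {0..<L} = (\<lambda>j. real j * s) ` {..<k}"
proof -
  have mult: "real j * s \<in> A" for j
  proof (induction j)
    case (Suc j)
    then show ?case
      using step [OF Suc] by (simp add: distrib_right add.commute)
  qed (simp add: zero)
  have only: "\<exists>j::nat. \<theta> = real j * s" if "\<theta> \<in> A" "0 \<le> \<theta>" for \<theta>
  proof -
    define j where "j = nat \<lfloor>\<theta> / s\<rfloor>"
    have "real j = of_int \<lfloor>\<theta> / s\<rfloor>"
      using that s by (simp add: j_def)
    then have "real j \<le> \<theta> / s" "\<theta> / s < real j + 1"
      by linarith+
    then have "real j * s \<le> \<theta>" "\<theta> < real j * s + s"
      using s by (simp_all add: field_simps)
    then show ?thesis
      using gap [OF mult [of j], of \<theta>] that(1) by (cases "real j * s = \<theta>") auto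
  qed
  obtain k where k: "L = real k * s"
    using only [OF L(2)] L(1) by auto
  have "A \<inter> {0..<L} = (\<lambda>j. real j * s) ` {..<k}"
  proof (intro equalityI subsetI)
    fix \<theta> assume \<theta>: "\<theta> \<in> A \<inter> {0..<L}"
    then obtain j where j: "\<theta> = real j * s"
      using only by auto
    then have "j < k"
      using \<theta> k s by simp
    then show "\<theta> \<in> (\<lambda>j. real j * s) ` {..<k}"
      using j by blast
  next
    fix \<theta> assume "\<theta> \<in> (\<lambda>j. real j * s) ` {..<k}"
    then show "\<theta> \<in> A \<inter> {0..<L}"
      using mult s k by auto
  qed
  with k show thesis
    by (rule that)
qed

lemma orthonormal_expansion:
  fixes e1 e2 e3 y :: "real^3"
  assumes "norm e1 = 1" "norm e2 = 1" "norm e3 = 1" "e1 \<bullet> e2 = 0" "e2 \<bullet> e3 = 0" "e1 \<bullet> e3 = 0"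
  shows "y = (y \<bullet> e1) *\<^sub>R e1 + (y \<bullet> e2) *\<^sub>R e2 + (y \<bullet> e3) *\<^sub>R e3"
proof -
  have g: "e1 \<bullet> e1 = 1" "e2 \<bullet> e2 = 1" "e3 \<bullet> e3 = 1" "e1 \<bullet> e2 = 0" "e2 \<bullet> e3 = 0" "e1 \<bullet> e3 = 0"
    "e2 \<bullet> e1 = 0" "e3 \<bullet> e2 = 0" "e3 \<bullet> e1 = 0"
    using assms by (auto simp: inner_commute norm_eq_1)
  have c: "(k *\<^sub>R e1 + l *\<^sub>R e2 + m *\<^sub>R e3) \<bullet> e1 = k" "(k *\<^sub>R e1 + l *\<^sub>R e2 + m *\<^sub>R e3) \<bullet> e2 = l"
    "(k *\<^sub>R e1 + l *\<^sub>R e2 + m *\<^sub>R e3) \<bullet> e3 = m" for k l m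
    by (simp_all add: inner_add_left g)
  have "k = 0 \<and> l = 0 \<and> m = 0" if "k *\<^sub>R e1 + l *\<^sub>R e2 + m *\<^sub>R e3 = 0" for k l m
    using c [of k l m] unfolding that by simp
  then have ind: "card {e1, e2, e3} = 3" "independent {e1, e2, e3}"
    by (rule independent_tripleI; blast)+
  obtain f g h :: "real^3 \<Rightarrow> real" where "linear f" "linear g" "linear h"
    and "f e1 = 1" "f e2 = 0" "f e3 = 0" "g e1 = 0" "g e2 = 1" "g e3 = 0" "h e1 = 0" "h e2 = 0" "h e3 = 1"
    and coords: "\<And>x k l m. x = k *\<^sub>R e1 + l *\<^sub>R e2 + m *\<^sub>R e3 \<longleftrightarrow> k = f x \<and> l = g x \<and> m = h x"
    by (rule triple_coordinates [OF ind]) (rule that)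
  have y: "y = f y *\<^sub>R e1 + g y *\<^sub>R e2 + h y *\<^sub>R e3"
    using coords by blast
  then have "y \<bullet> e1 = f y" "y \<bullet> e2 = g y" "y \<bullet> e3 = h y"
    using c [of "f y" "g y" "h y"] by simp_all
  then show ?thesis
    using y by simp
qed

text \<open>The third entries of the chambers at \<open>v\<close> lie on a circle around \<open>v\<close>. Exchanging the
third entry of \<open>(v, b, c)\<close> turns it by twice the angle at \<open>v\<close>, with \<open>b\<close> pointing to the middle
of the turn, and if \<open>b\<close> is exchanged beforehand, the turn goes in the opposite direction. Since
no third entry is closer to \<open>b\<close> than \<open>c\<close>, by the last assumption, none is passed on the way.
Hence the turns that lead once around the circle are as many as the third entries.\<close>

lemma vertex_angle_count:
  assumes \<Phi>: "chamber_system x z \<Phi>" and flag: "(v, b0, c0) \<in> \<Phi>"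
    and sup: "\<And>b c b' c'. (v, b, c) \<in> \<Phi> \<Longrightarrow> (v, b', c') \<in> \<Phi> \<Longrightarrow> b \<bullet> c' \<le> z"
  shows "real (card {c. \<exists>b. (v, b, c) \<in> \<Phi>}) * right_angle_at x z = pi"
proof -
  define Z where "Z = {c. \<exists>b. (v, b, c) \<in> \<Phi>}"
  define \<alpha> where "\<alpha> = right_angle_at x z"
  define \<rho> where "\<rho> = sqrt (1 - x\<^sup>2 * z\<^sup>2)"
  define \<sigma> where "\<sigma> = sqrt (1 - x\<^sup>2)"
  have xz: "0 < x" "x < 1" "0 < z" "z < 1"
    using chamber_systemD(1-4) [OF \<Phi>] by simp_all
  have rt: "right_triple x z v b c" if "(v, b, c) \<in> \<Phi>" for b c
    using chamber_systemD(6) [OF \<Phi> that] .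
  have \<alpha>: "0 < \<alpha>" "\<alpha> < pi/2" "cos \<alpha> = z * \<sigma> / \<rho>"
    using right_angle_at_bounds [OF xz] by (simp_all add: \<alpha>_def \<rho>_def \<sigma>_def)
  have sq: "0 < 1 - x\<^sup>2" "0 < 1 - z\<^sup>2" "0 < x\<^sup>2" "0 < z\<^sup>2"
    using xz by (simp_all add: power_less_one_iff)
  have "x\<^sup>2 * z\<^sup>2 < 1 * 1"
    using sq by (intro mult_strict_mono) auto
  then have pos: "0 < \<rho>" "0 < \<sigma>"
    using sq by (simp_all add: \<rho>_def \<sigma>_def)
  have \<sigma>2: "\<sigma> * \<sigma> = 1 - x\<^sup>2"
    using sq by (simp add: \<sigma>_def)
  \<comment> \<open>polar coordinates in the tangent plane at \<open>v\<close>\<close>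
  define e1 where "e1 = (c0 - (x * z) *\<^sub>R v) /\<^sub>R \<rho>"
  define e2 where "e2 = cross3 v e1"
  have v1: "norm v = 1" "v \<bullet> v = 1"
    using rt [OF flag] by (simp_all add: right_triple_def norm_eq_1)
  have e1: "norm e1 = 1" "v \<bullet> e1 = 0"
    using right_triple_tangents(3) [OF xz rt [OF flag]] pos rt [OF flag] v1
    by (simp_all add: e1_def \<rho>_def [symmetric] right_triple_def inner_diff_right)
  have e2: "v \<bullet> e2 = 0" "e1 \<bullet> e2 = 0"
    by (simp_all add: e2_def dot_cross_self)
  have "(norm e2)\<^sup>2 = 1"
    using norm_cross [of v e1] v1 e1 by (simp add: e2_def)
  then have n2: "norm e2 = 1"
    by (simp add: power2_eq_1_iff) (metis norm_ge_zero neg_0_le_iff_le not_one_le_zero)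
  have E: "e1 \<bullet> e1 = 1" "e2 \<bullet> e2 = 1" "e1 \<bullet> v = 0" "e2 \<bullet> v = 0" "e2 \<bullet> e1 = 0"
    using e1 e2 n2 by (simp_all add: inner_commute norm_eq_1)
  have polar: "\<exists>\<theta>. 0 \<le> \<theta> \<and> \<theta> < 2 * pi \<and> w = r *\<^sub>R (cos \<theta> *\<^sub>R e1 + sin \<theta> *\<^sub>R e2)"
    if "w \<bullet> v = 0" "norm w = r" "0 < r" for w r
  proof -
    have w: "w = (w \<bullet> e1) *\<^sub>R e1 + (w \<bullet> e2) *\<^sub>R e2"
      using orthonormal_expansion [OF v1(1) e1(1) n2 e1(2) e2(2,1), of w] that(1) by simp
    have "r\<^sup>2 = w \<bullet> w"
      using that(2) power2_norm_eq_inner [of w] by simp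
    also have "\<dots> = ((w \<bullet> e1) *\<^sub>R e1 + (w \<bullet> e2) *\<^sub>R e2) \<bullet> ((w \<bullet> e1) *\<^sub>R e1 + (w \<bullet> e2) *\<^sub>R e2)"
      using w by simp
    also have "\<dots> = (w \<bullet> e1)\<^sup>2 + (w \<bullet> e2)\<^sup>2"
      by (simp add: inner_add_left inner_add_right E e2 power2_eq_square)
    finally have r2: "r\<^sup>2 = (w \<bullet> e1)\<^sup>2 + (w \<bullet> e2)\<^sup>2" .
    have "((w \<bullet> e1) / r)\<^sup>2 + ((w \<bullet> e2) / r)\<^sup>2 = ((w \<bullet> e1)\<^sup>2 + (w \<bullet> e2)\<^sup>2) / r\<^sup>2"
      by (simp add: power_divide add_divide_distrib)
    also have "\<dots> = 1"
      using that(3) unfolding r2 [symmetric] by simp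
    finally have "((w \<bullet> e1) / r)\<^sup>2 + ((w \<bullet> e2) / r)\<^sup>2 = 1" .
    then obtain t where t: "0 \<le> t" "t < 2 * pi" "(w \<bullet> e1) / r = cos t" "(w \<bullet> e2) / r = sin t"
      using sincos_total_2pi by metis
    then have "w \<bullet> e1 = r * cos t" "w \<bullet> e2 = r * sin t"
      using that(3) by (simp_all add: field_simps)
    then have "w = r *\<^sub>R (cos t *\<^sub>R e1 + sin t *\<^sub>R e2)"
      using w by (simp add: scaleR_add_right)
    with t(1,2) show ?thesis
      by blast
  qed
  define B where "B \<theta> = x *\<^sub>R v + \<sigma> *\<^sub>R (cos \<theta> *\<^sub>R e1 + sin \<theta> *\<^sub>R e2)" for \<theta>
  define C where "C \<theta> = (x * z) *\<^sub>R v + \<rho> *\<^sub>R (cos \<theta> *\<^sub>R e1 + sin \<theta> *\<^sub>R e2)" for \<theta>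
  have B: "\<exists>\<theta>. b = B \<theta>" if "(v, b, c) \<in> \<Phi>" for b c
  proof -
    have "b \<bullet> v = x"
      using rt [OF that] by (simp add: right_triple_def inner_commute)
    then have "(b - x *\<^sub>R v) \<bullet> v = 0"
      using v1 by (simp add: inner_diff_left)
    moreover have "norm (b - x *\<^sub>R v) = \<sigma>"
      unfolding \<sigma>_def by (rule right_triple_tangents(2) [OF xz rt [OF that]])
    ultimately obtain \<theta> where "b - x *\<^sub>R v = \<sigma> *\<^sub>R (cos \<theta> *\<^sub>R e1 + sin \<theta> *\<^sub>R e2)"
      using polar pos by blast
    then show ?thesis
      by (auto simp: B_def algebra_simps)
  qed
  have C: "\<exists>\<theta>. 0 \<le> \<theta> \<and> \<theta> < 2 * pi \<and> c = C \<theta>" if "(v, b, c) \<in> \<Phi>" for b c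
  proof -
    have "c \<bullet> v = x * z"
      using rt [OF that] by (simp add: right_triple_def inner_commute)
    then have "(c - (x * z) *\<^sub>R v) \<bullet> v = 0"
      using v1 by (simp add: inner_diff_left)
    moreover have "norm (c - (x * z) *\<^sub>R v) = \<rho>"
      unfolding \<rho>_def by (rule right_triple_tangents(3) [OF xz rt [OF that]])
    ultimately obtain \<theta> where "0 \<le> \<theta> \<and> \<theta> < 2 * pi \<and> c - (x * z) *\<^sub>R v = \<rho> *\<^sub>R (cos \<theta> *\<^sub>R e1 + sin \<theta> *\<^sub>R e2)"
      using polar pos by blast
    then show ?thesis
      by (auto simp: C_def algebra_simps)
  qed
  have per: "B (\<theta> + 2 * n * pi) = B \<theta>" "C (\<theta> + 2 * n * pi) = C \<theta>" if "n \<in> \<int>" for \<theta> n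
  proof -
    have n: "2 * n * pi = 2 * pi * n"
      by simp
    have "cos (2 * n * pi) = 1" "sin (2 * n * pi) = 0"
      unfolding n by (fact cos_integer_2pi [OF that] sin_integer_2pi [OF that])+
    then have "cos (\<theta> + 2 * n * pi) = cos \<theta>" "sin (\<theta> + 2 * n * pi) = sin \<theta>"
      by (simp_all add: cos_add sin_add)
    then show "B (\<theta> + 2 * n * pi) = B \<theta>" "C (\<theta> + 2 * n * pi) = C \<theta>"
      by (simp_all add: B_def C_def)
  qed
  have BC: "B \<phi> \<bullet> C \<theta> - z = \<sigma> * \<rho> * (cos (\<phi> - \<theta>) - cos \<alpha>)" for \<phi> \<theta>
  proof -
    have "B \<phi> \<bullet> C \<theta> = x * (x * z) + \<sigma> * \<rho> * cos (\<phi> - \<theta>)"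
      by (simp add: B_def C_def inner_add_left inner_add_right E e1 e2 v1 cos_diff algebra_simps)
    moreover have "\<sigma> * \<rho> * cos \<alpha> = z * (\<sigma> * \<sigma>)"
      using pos by (simp add: \<alpha>)
    ultimately show ?thesis
      unfolding \<sigma>2 by (simp add: algebra_simps power2_eq_square)
  qed
  have adj: "\<phi> - \<theta> = \<alpha> + 2 * n * pi \<or> \<phi> - \<theta> = - \<alpha> + 2 * n * pi \<Longrightarrow> n \<in> \<int> \<Longrightarrow>
      (B \<phi> = B (\<theta> + \<alpha>) \<and> C \<theta> = C (\<phi> - \<alpha>)) \<or> (B \<phi> = B (\<theta> - \<alpha>) \<and> C \<theta> = C (\<phi> + \<alpha>))" for \<phi> \<theta> n
  proof -
    assume n: "n \<in> \<int>" and "\<phi> - \<theta> = \<alpha> + 2 * n * pi \<or> \<phi> - \<theta> = - \<alpha> + 2 * n * pi"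
    then have "(\<phi> = (\<theta> + \<alpha>) + 2 * n * pi \<and> \<phi> - \<alpha> = \<theta> + 2 * n * pi) \<or>
      (\<phi> = (\<theta> - \<alpha>) + 2 * n * pi \<and> \<phi> + \<alpha> = \<theta> + 2 * n * pi)"
      by auto
    then show ?thesis
      using per [OF n] by metis
  qed
  have nbr: "(B \<phi> = B (\<theta> + \<alpha>) \<and> C \<theta> = C (\<phi> - \<alpha>)) \<or> (B \<phi> = B (\<theta> - \<alpha>) \<and> C \<theta> = C (\<phi> + \<alpha>))"
    if "(v, B \<phi>, C \<theta>) \<in> \<Phi>" for \<phi> \<theta>
  proof -
    have "B \<phi> \<bullet> C \<theta> = z"
      using rt [OF that] by (simp add: right_triple_def)
    then have "cos (\<phi> - \<theta>) = cos \<alpha>"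
      using BC [of \<phi> \<theta>] pos by simp
    then show ?thesis
      using adj unfolding cos_eq by blast
  qed
  have turn: "(v, B (\<theta> + \<alpha>), C \<theta>) \<in> \<Phi>" if \<theta>: "C \<theta> \<in> Z" for \<theta>
  proof -
    obtain b where b: "(v, b, C \<theta>) \<in> \<Phi>"
      using \<theta> by (auto simp: Z_def)
    obtain b' where b': "b' \<noteq> b" "(v, b', C \<theta>) \<in> \<Phi>"
      using chamber_systemD(8) [OF \<Phi> b] by blast
    obtain \<phi> \<phi>' where "b = B \<phi>" "b' = B \<phi>'"
      using B b b'(2) by metis
    then show ?thesis
      using nbr [of \<phi> \<theta>] nbr [of \<phi>' \<theta>] b b' by metis
  qed
  define A where "A = {\<theta>. C \<theta> \<in> Z}"
  have "0 < 2 * \<alpha>" "0 < 2 * pi"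
    using \<alpha> by simp_all
  moreover have "C 0 = c0"
    using pos by (simp add: C_def e1_def)
  then have "0 \<in> A"
    using flag by (auto simp: A_def Z_def)
  moreover have "2 * pi \<in> A"
    using \<open>0 \<in> A\<close> per(2) [of 1 0] by (simp add: A_def)
  moreover have "\<theta> + 2 * \<alpha> \<in> A" if "\<theta> \<in> A" for \<theta>
  proof -
    have f: "(v, B (\<theta> + \<alpha>), C \<theta>) \<in> \<Phi>"
      using turn that by (simp add: A_def)
    obtain c' where c': "c' \<noteq> C \<theta>" "(v, B (\<theta> + \<alpha>), c') \<in> \<Phi>"
      using chamber_systemD(9) [OF \<Phi> f] by blast
    then obtain \<theta>' where \<theta>': "c' = C \<theta>'"
      using C by metis
    have "C \<theta>' = C (\<theta> + \<alpha> - \<alpha>) \<or> C \<theta>' = C (\<theta> + \<alpha> + \<alpha>)"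
      using nbr c'(2) unfolding \<theta>' by blast
    then have "c' = C (\<theta> + 2 * \<alpha>)"
      using c'(1) \<theta>' by (simp add: add.assoc)
    then show ?thesis
      using c'(2) by (auto simp: A_def Z_def)
  qed
  moreover have "\<psi> \<notin> A" if "\<theta> \<in> A" "\<theta> < \<psi>" "\<psi> < \<theta> + 2 * \<alpha>" for \<theta> \<psi>
  proof
    assume "\<psi> \<in> A"
    then obtain b' where "(v, b', C \<psi>) \<in> \<Phi>"
      by (auto simp: A_def Z_def)
    moreover have "(v, B (\<theta> + \<alpha>), C \<theta>) \<in> \<Phi>"
      using turn that(1) by (simp add: A_def)
    ultimately have "B (\<theta> + \<alpha>) \<bullet> C \<psi> - z \<le> 0"
      using sup by simp
    then have "cos (\<theta> + \<alpha> - \<psi>) \<le> cos \<alpha>"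
      unfolding BC using pos by (simp add: mult_le_0_iff)
    moreover have "\<bar>\<theta> + \<alpha> - \<psi>\<bar> < \<alpha>"
      using that(2,3) by auto
    then have "cos \<alpha> < cos \<bar>\<theta> + \<alpha> - \<psi>\<bar>"
      using \<alpha>(1,2) by (intro cos_monotone_0_pi) auto
    ultimately show False
      by simp
  qed
  ultimately obtain k where k: "2 * pi = real k * (2 * \<alpha>)"
    and Ak: "A \<inter> {0..<2 * pi} = (\<lambda>j. real j * (2 * \<alpha>)) ` {..<k}"
    using progression_count [of "2 * \<alpha>" "2 * pi" A] by metis
  have "Z = C ` (A \<inter> {0..<2 * pi})"
    using C unfolding A_def Z_def by fastforce
  moreover have "inj_on C {0..<2 * pi}"
  proof (rule inj_onI)
    fix s t assume st: "s \<in> {0..<2 * pi}" "t \<in> {0..<2 * pi}" "C s = C t"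
    have "C u \<bullet> e1 = \<rho> * cos u" "C u \<bullet> e2 = \<rho> * sin u" for u
      by (simp_all add: C_def inner_add_left E e1 e2)
    then have "cos s = cos t" "sin s = sin t"
      using st(3) pos by (metis mult_cancel_left less_irrefl)+
    then obtain m :: int where m: "s = t + 2 * pi * of_int m"
      using sin_cos_eq_iff [of s t] by blast
    have "0 \<le> s" "s < 2 * pi" "0 \<le> t" "t < 2 * pi"
      using st(1,2) by auto
    then have "2 * pi * of_int m < 2 * pi * 1" "2 * pi * (-1) < 2 * pi * of_int m"
      using m by linarith+
    then have "real_of_int m < 1" "-1 < real_of_int m"
      using pi_gt_zero by (simp_all only: mult_less_cancel_left_pos mult_pos_pos zero_less_numeral)
    then show "s = t"
      using m by simp
  qed
  ultimately have "card Z = card (A \<inter> {0..<2 * pi})"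
    by (simp add: card_image inj_on_subset)
  also have "\<dots> = k"
    unfolding Ak using \<alpha>(1) by (subst card_image) (auto intro!: inj_onI)
  finally show ?thesis
    using k by (simp add: Z_def \<alpha>_def)
qed

section \<open>Faces of polytopes\<close>

lemma polytope_hull_extreme_points:
  fixes S :: "'a::euclidean_space set"
  assumes "polytope S"
  shows "S = convex hull {v. v extreme_point_of S}"
  by (rule Krein_Milman_Minkowski [OF polytope_imp_compact [OF assms] polytope_imp_convex [OF assms]])

lemma polytope_extreme_points:
  assumes "polytope (S :: 'a::euclidean_space set)" "S \<noteq> {}"
  shows "finite {v. v extreme_point_of S}" "{v. v extreme_point_of S} \<noteq> {}"
  using finite_polyhedron_extreme_points [OF polytope_imp_polyhedron [OF assms(1)]]
    polytope_hull_extreme_points [OF assms(1)] assms(2) by force+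

text \<open>Otherwise a functional that supports \<open>S\<close> at the mean of the vertices would take its minimum
over \<open>S\<close> at every vertex, and thus be constant on \<open>S\<close>.\<close>

lemma centre_in_rel_interior:
  assumes S: "polytope S" "S \<noteq> {}"
  shows "centre S \<in> rel_interior S"
proof (rule ccontr)
  assume no: "centre S \<notin> rel_interior S"
  define V where "V = {v. v extreme_point_of S}"
  have V: "finite V" "V \<noteq> {}"
    using polytope_extreme_points [OF S] by (simp_all add: V_def)
  have cvx: "convex S"
    by (rule polytope_imp_convex [OF S(1)])
  have VS: "V \<subseteq> S"
    by (auto simp: V_def extreme_point_of_def)
  have card: "real (card V) > 0"
    using V by (simp add: card_gt_0_iff)
  have c: "centre S = (\<Sum>v\<in>V. (1 / real (card V)) *\<^sub>R v)"
    unfolding centre_def V_def [symmetric] by (simp add: scaleR_right.sum divide_inverse)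
  have "centre S \<in> S"
    unfolding c using V VS card by (intro convex_sum [OF V(1) cvx]) auto
  then obtain a where a: "\<And>y. y \<in> S \<Longrightarrow> a \<bullet> centre S \<le> a \<bullet> y"
      "\<And>y. y \<in> rel_interior S \<Longrightarrow> a \<bullet> centre S < a \<bullet> y"
    using supporting_hyperplane_rel_boundary [OF cvx _ no] by metis
  have "(\<Sum>v\<in>V. a \<bullet> v - a \<bullet> centre S) = 0"
  proof -
    have "a \<bullet> centre S * real (card V) = a \<bullet> (\<Sum>v\<in>V. v)"
      using card by (simp add: centre_def V_def [symmetric])
    then show ?thesis
      by (simp add: sum_subtractf inner_sum_right mult.commute)
  qed
  then have "\<forall>v\<in>V. a \<bullet> v - a \<bullet> centre S = 0"
    using a(1) VS V(1) by (subst (asm) sum_nonneg_eq_0_iff) auto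
  then have "V \<subseteq> {y. a \<bullet> y = a \<bullet> centre S}"
    by auto
  then have "convex hull V \<subseteq> {y. a \<bullet> y = a \<bullet> centre S}"
    by (simp add: hull_minimal convex_hyperplane)
  then have "S \<subseteq> {y. a \<bullet> y = a \<bullet> centre S}"
    using polytope_hull_extreme_points [OF S(1)] by (simp add: V_def)
  moreover obtain y where "y \<in> rel_interior S"
    using rel_interior_eq_empty [OF cvx] S(2) by blast
  moreover have "y \<in> S"
    using \<open>y \<in> rel_interior S\<close> rel_interior_subset by blast
  ultimately show False
    using a(2) by force
qed

text \<open>Different faces have disjoint relative interiors, so that the centre of a face can stand for
the face.\<close>

lemma face_eq_if_centre_eq:
  assumes "polytope S" "E face_of S" "E' face_of S" "E \<noteq> {}" "E' \<noteq> {}" "centre E = centre E'"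
  shows "E = E'"
proof (rule face_of_eq [OF assms(2,3)])
  show "rel_interior E \<inter> rel_interior E' \<noteq> {}"
    using centre_in_rel_interior [OF face_of_polytope_polytope [OF assms(1,2)] assms(4)]
      centre_in_rel_interior [OF face_of_polytope_polytope [OF assms(1,3)] assms(5)] assms(6) by auto
qed

text \<open>A proper face is the intersection of the facets that contain it, which cannot be \<open>F\<close> alone.\<close>

lemma face_in_second_facet:
  assumes S: "polytope S" and E: "E face_of S" "E \<noteq> {}" and F: "F facet_of S" "E \<subseteq> F" "E \<noteq> F"
  obtains G where "G facet_of S" "G \<noteq> F" "E \<subseteq> G"
proof -
  have "F \<noteq> S"
    using F(1) by auto
  moreover have "F \<subseteq> S"
    using F(1) facet_of_imp_subset by blast
  ultimately have "E \<noteq> S"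
    using F(2) by auto
  then have "E = \<Inter>{G. G facet_of S \<and> E \<subseteq> G}"
    by (intro face_of_polyhedron [OF polytope_imp_polyhedron [OF S] E(1,2)])
  then show thesis
    using F that by blast
qed

lemma edge_endpoints:
  assumes S: "polytope S" and e: "e edge_of S"
  obtains a b where "a \<noteq> b" "e = closed_segment a b" "{v. v extreme_point_of e} = {a, b}"
    "centre e = (1/2) *\<^sub>R (a + b)"
proof -
  have "e face_of S" "aff_dim e = 1"
    using e by (auto simp: edge_of_def)
  then have "polytope e"
    using S face_of_polytope_polytope by blast
  moreover have "e \<noteq> {}"
    using \<open>aff_dim e = 1\<close> by auto
  ultimately obtain a b where ab: "e = closed_segment a b"
    using compact_convex_collinear_segment [of e] \<open>aff_dim e = 1\<close>
    by (auto simp: polytope_imp_compact polytope_imp_convex collinear_aff_dim)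
  have "a \<noteq> b"
    using \<open>aff_dim e = 1\<close> ab by auto
  moreover have ext: "{v. v extreme_point_of e} = {a, b}"
    by (auto simp: ab extreme_point_of_segment)
  moreover have "centre e = (1/2) *\<^sub>R (a + b)"
    unfolding centre_def ext using \<open>a \<noteq> b\<close> by simp
  ultimately show thesis
    using ab by (intro that)
qed

text \<open>Without one of its points the boundary of a solid is homeomorphic to a plane, which stays
connected when finitely many further points are removed.\<close>

lemma connected_rel_frontier_minus_finite:
  fixes S :: "'a::euclidean_space set"
  assumes "convex S" "bounded S" "aff_dim S = 3" "finite N" "N \<subseteq> rel_frontier S"
  shows "connected (rel_frontier S - N)"
proof (cases "N = {}")
  case True
  then show ?thesis
    using connected_sphere_gen [OF assms(1,2)] assms(3) by simp
next
  case False
  then obtain a where a: "a \<in> N"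
    by auto
  obtain T :: "'a set" where T: "affine T" "aff_dim T = 2"
  proof (rule choose_affine_subset [OF affine_UNIV, of 2])
    show "2 \<le> aff_dim (UNIV :: 'a set)"
      using aff_dim_le_DIM [of S] assms(3) by simp
  qed (auto intro: that)
  have "rel_frontier S - {a} homeomorphic T"
    by (rule homeomorphic_punctured_sphere_affine_gen) (use assms a T in auto)
  then obtain f g where fg: "homeomorphism (rel_frontier S - {a}) T f g"
    unfolding homeomorphic_def by blast
  have "connected (T - f ` (N - {a}))"
  proof (rule connected_convex_diff_countable)
    show "\<not> collinear T"
      using T(2) by (simp add: collinear_aff_dim)
    show "convex T"
      by (rule affine_imp_convex [OF T(1)])
    show "countable (f ` (N - {a}))"
      using assms(4) by (simp add: countable_finite)
  qed
  moreover have "continuous_on (T - f ` (N - {a})) g"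
    using homeomorphism_cont2 [OF fg] by (rule continuous_on_subset) auto
  moreover have "g ` (T - f ` (N - {a})) = rel_frontier S - N"
  proof -
    have gT: "g ` T = rel_frontier S - {a}" and gf: "\<And>x. x \<in> rel_frontier S - {a} \<Longrightarrow> g (f x) = x"
      and fgy: "\<And>y. y \<in> T \<Longrightarrow> f (g y) = y"
      using fg by (auto simp: homeomorphism_def)
    have "inj_on g T"
      by (rule inj_on_inverseI) (rule fgy)
    then have "g ` (T - f ` (N - {a})) = g ` T - g ` f ` (N - {a})"
      using fg assms(5) by (intro inj_on_image_set_diff [of g T]) (auto simp: homeomorphism_def)
    also have "g ` f ` (N - {a}) = N - {a}"
      using gf assms(5) by force
    finally show ?thesis
      using gT a by auto
  qed
  ultimately show ?thesis
    using connected_continuous_image by metis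
qed

text \<open>Suppose that the facets fall into two classes and that no facet of one shares a ridge with a
facet of the other. The unions of the two classes are closed, cover the boundary, and meet at
most in vertices; for a polygon they do not meet at all. This contradicts the connectedness of
the boundary, from which the vertices are removed in the case of a solid.\<close>

lemma facets_connected:
  fixes S :: "'a::euclidean_space set"
  assumes S: "polytope S" and dim: "aff_dim S = 2 \<or> aff_dim S = 3"
    and C: "C \<subseteq> {F. F facet_of S}" "F0 \<in> C"
    and adj: "\<And>F G. F \<in> C \<Longrightarrow> G facet_of S \<Longrightarrow> aff_dim (F \<inter> G) = aff_dim S - 2 \<Longrightarrow> G \<in> C"
  shows "C = {F. F facet_of S}"
proof (rule ccontr)
  assume "C \<noteq> {F. F facet_of S}"
  then obtain G0 where G0: "G0 facet_of S" "G0 \<notin> C"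
    using C by auto
  define D where "D = {F. F facet_of S} - C"
  define N where "N = (if aff_dim S = 3 then {v. v extreme_point_of S} else {})"
  have fin: "finite C" "finite D"
    using finite_polytope_facets [OF S] C(1) by (auto simp: D_def intro: finite_subset)
  have cvx: "convex S" "bounded S"
    using S by (simp_all add: polytope_imp_convex polytope_imp_bounded)
  have fr: "rel_frontier S = \<Union>C \<union> \<Union>D"
    using rel_frontier_of_polyhedron [OF polytope_imp_polyhedron [OF S]] C(1) by (auto simp: D_def)
  have "finite N"
    using finite_polyhedron_extreme_points [OF polytope_imp_polyhedron [OF S]] by (simp add: N_def)
  have "N \<subseteq> rel_frontier S"
  proof (clarsimp simp: N_def)
    fix v assume v: "aff_dim S = 3" "v extreme_point_of S"
    then have "{v} face_of S" "{v} \<noteq> S"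
      by (auto simp: face_of_singleton)
    then show "v \<in> rel_frontier S"
      using face_of_subset_rel_frontier by blast
  qed
  then have conn: "connected (rel_frontier S - N)"
    using connected_rel_frontier_minus_finite [OF cvx _ \<open>finite N\<close>] connected_sphere_gen [OF cvx] dim
    by (auto simp: N_def)
  have "closed F" if "F facet_of S" for F
    using that S by (meson face_of_imp_closed facet_of_imp_face_of polytope_imp_convex polytope_imp_closed)
  then have cl: "closed (\<Union>C)" "closed (\<Union>D)"
    using fin C(1) by (auto simp: D_def intro: closed_Union)
  \<comment> \<open>A common point of two facets that share no ridge is a vertex of a solid.\<close>
  have "\<Union>C \<inter> \<Union>D \<subseteq> N"
  proof clarify
    fix x F G assume *: "x \<in> F" "F \<in> C" "x \<in> G" "G \<in> D"
    have F: "F facet_of S" and G: "G facet_of S" and "F \<noteq> G"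
      using * C(1) by (auto simp: D_def)
    have FG: "F \<inter> G face_of S"
      using F G by (simp add: face_of_Int facet_of_imp_face_of)
    have "F \<inter> G \<noteq> F"
    proof
      assume "F \<inter> G = F"
      then have "F face_of G"
        using F G by (metis face_of_subset facet_of_imp_face_of facet_of_imp_subset inf.cobounded2)
      moreover have "convex G"
        using G cvx by (meson face_of_imp_convex facet_of_imp_face_of)
      ultimately have "aff_dim F < aff_dim G"
        using \<open>F \<noteq> G\<close> by (intro face_of_aff_dim_lt)
      then show False
        using F G by (simp add: facet_of_def)
    qed
    moreover have "F \<inter> G face_of F"
      using FG F by (meson face_of_subset facet_of_imp_subset inf.cobounded1)
    moreover have "convex F"
      using F cvx by (meson face_of_imp_convex facet_of_imp_face_of)
    ultimately have "aff_dim (F \<inter> G) < aff_dim S - 1"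
      using face_of_aff_dim_lt [of F "F \<inter> G"] F by (simp add: facet_of_def)
    moreover have "aff_dim (F \<inter> G) \<noteq> aff_dim S - 2"
      using adj [OF *(2) G] *(4) by (auto simp: D_def)
    moreover have "0 \<le> aff_dim (F \<inter> G)"
      using *(1,3) by (metis IntI aff_dim_geq aff_dim_empty empty_iff linorder_not_le order_less_le zle_diff1_eq diff_0)
    ultimately have "aff_dim (F \<inter> G) = 0" "aff_dim S = 3"
      using dim by linarith+
    then obtain y where y: "F \<inter> G = {y}"
      using aff_dim_eq_0 by blast
    then have "F \<inter> G = {x}"
      using *(1,3) by auto
    then show "x \<in> N"
      using FG \<open>aff_dim S = 3\<close> by (simp add: N_def face_of_singleton [symmetric])
  qed
  moreover have "\<not> F \<subseteq> N" if "F facet_of S" for F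
  proof
    assume "F \<subseteq> N"
    have "aff_dim F \<le> 0"
    proof (cases "aff_dim S = 3")
      case True
      have "F face_of S" "F \<noteq> {}"
        using that by (auto simp: facet_of_def)
      moreover have "convex F"
        using \<open>F face_of S\<close> by (rule face_of_imp_convex)
      ultimately obtain x where x: "x \<in> rel_interior F"
        using rel_interior_eq_empty by blast
      then have "x \<in> F"
        using rel_interior_subset by blast
      then have "x extreme_point_of S"
        using \<open>F \<subseteq> N\<close> True by (auto simp: N_def)
      then have "x extreme_point_of F"
        using \<open>x \<in> F\<close> extreme_point_of_face [OF \<open>F face_of S\<close>] by blast
      then have "F = {x}"
        using x extreme_point_not_in_REL_INTERIOR by blast
      then show ?thesis
        by simp
    next
      case False
      then show ?thesis
        using \<open>F \<subseteq> N\<close> by (simp add: N_def)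
    qed
    then show False
      using that dim by (auto simp: facet_of_def)
  qed
  then have "\<not> F0 \<subseteq> N" "\<not> G0 \<subseteq> N"
    using C G0 by auto
  moreover have "F0 \<subseteq> \<Union>C" "G0 \<subseteq> \<Union>D"
    using C(2) G0 by (auto simp: D_def)
  ultimately have "\<Union>C \<inter> (rel_frontier S - N) \<noteq> {}" "\<Union>D \<inter> (rel_frontier S - N) \<noteq> {}"
    "\<Union>C \<inter> \<Union>D \<inter> (rel_frontier S - N) = {}"
    unfolding fr by blast+
  then show False
    using conn cl fr unfolding connected_closed by blast
qed

section \<open>Regular polygons\<close>

text \<open>The cosine decreases on the multiples of \<open>pi / p\<close> up to \<open>pi\<close> and is even, so that \<open>D\<close> is
congruent to \<open>1\<close> or \<open>-1\<close> modulo \<open>2 * p\<close>.\<close>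

lemma cos_ge_cos_step:
  fixes D :: int
  assumes p: "2 \<le> p" and ge: "cos (pi / real p) \<le> cos (pi * of_int D / real p)"
    and ne: "\<not> int p dvd D"
  shows "(sin (pi * of_int D / real p))\<^sup>2 = (sin (pi / real p))\<^sup>2"
proof -
  define E where "E = D mod (2 * int p)"
  define f where "f = (\<lambda>k::int. cos (pi * of_int k / real p))"
  have E: "0 \<le> E" "E < 2 * int p"
    using p by (simp_all add: E_def)
  define n where "n = D div (2 * int p)"
  have "D = E + 2 * int p * n"
    by (simp add: E_def n_def)
  then have "pi * of_int D / real p = pi * of_int E / real p + 2 * pi * of_int n"
    using p by (simp add: field_simps)
  then have fD: "f D = f E"
    by (simp add: f_def cos_add)
  have "E \<noteq> 0"
    using ne by (auto simp: E_def dvd_def mod_eq_0_iff_dvd)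
  have dec: "f k < f 1" if "2 \<le> k" "k \<le> int p" for k
    unfolding f_def
  proof (rule cos_monotone_0_pi)
    have k: "real_of_int k \<le> real p" "1 < real_of_int k"
      using that by linarith+
    show "pi * of_int k / real p \<le> pi" "pi * of_int 1 / real p < pi * of_int k / real p"
      using k p by (simp_all add: divide_strict_right_mono field_simps)
  qed (use p in auto)
  have refl: "f (2 * int p - k) = f k" for k
  proof -
    have "pi * of_int (2 * int p - k) / real p = 2 * pi - pi * of_int k / real p"
      using p by (simp add: field_simps)
    then show ?thesis
      by (simp add: f_def cos_diff)
  qed
  have "f 1 \<le> f E"
    using ge unfolding fD [symmetric] by (simp add: f_def)
  then have "\<not> (2 \<le> E \<and> E \<le> int p)" "\<not> (2 \<le> 2 * int p - E \<and> 2 * int p - E \<le> int p)"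
    using dec [of E] dec [of "2 * int p - E"] refl [of E] by auto
  then have "E = 1 \<or> E = 2 * int p - 1"
    using E \<open>E \<noteq> 0\<close> by linarith
  then have "f D = f 1"
    using fD refl [of 1] by auto
  then show ?thesis
    by (simp add: f_def sin_squared_eq)
qed

text \<open>The given points are extreme because a disc is strictly convex, and their mean is the centre
of the circle because the roots of unity add up to zero. As to the edges, a functional that
exposes an edge takes its maximum at both end points, so that its direction bisects the angle
between them. Some vertex is at most half a step away from this direction, hence so are the
two end points, which makes them neighbours on the circle.\<close>

lemma regular_polygon_metric:
  assumes "regular_polygon p r F"
  shows "p \<ge> 3" "r > 0"
    and "\<And>v. v extreme_point_of F \<Longrightarrow> norm (v - centre F) = r"
    and "\<And>v w. closed_segment v w edge_of F \<Longrightarrow> norm (v - w) = 2 * r * sin (pi / real p)"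
proof -
  obtain c a b where p: "p \<ge> 3" and r: "r > 0" and ab: "norm a = 1" "norm b = 1" "a \<bullet> b = 0"
    and F: "F = convex hull ((\<lambda>k. c + r *\<^sub>R (cos (2 * pi * real k / real p) *\<^sub>R a
                          + sin (2 * pi * real k / real p) *\<^sub>R b)) ` {..<p})"
    using assms unfolding regular_polygon_def by auto
  have g: "a \<bullet> a = 1" "b \<bullet> b = 1" "b \<bullet> a = 0"
    using ab by (simp_all add: norm_eq_1 inner_commute)
  define \<theta> where "\<theta> = (\<lambda>k::int. 2 * pi * of_int k / real p)"
  define u where "u = (\<lambda>k::int. cos (\<theta> k) *\<^sub>R a + sin (\<theta> k) *\<^sub>R b)"
  define W where "W = (\<lambda>k. c + r *\<^sub>R u (int k)) ` {..<p}"
  have FW: "F = convex hull W"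
    by (simp add: F W_def u_def \<theta>_def)
  then have poly: "polytope F"
    by (simp add: polytope_convex_hull W_def)
  show "p \<ge> 3" "r > 0"
    by (fact p r)+
  have uu: "u j \<bullet> u k = cos (\<theta> j - \<theta> k)" for j k
    by (simp add: u_def inner_add_left inner_add_right g ab cos_diff)
  have nu: "norm (u k) = 1" for k
    by (simp add: norm_eq_1 uu)
  have per: "u (k + int p * n) = u k" for k n
  proof -
    have "\<theta> (k + int p * n) = \<theta> k + 2 * pi * of_int n"
      using p by (simp add: \<theta>_def field_simps)
    then show ?thesis
      by (simp add: u_def cos_add sin_add)
  qed
  have uW: "c + r *\<^sub>R u k \<in> W" for k
  proof -
    have "u k = u (k mod int p)"
      using per [of "k mod int p" "k div int p"] by (simp add: mult.commute)
    moreover have "k mod int p = int (nat (k mod int p))" "nat (k mod int p) < p"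
      using p by (simp_all add: nat_less_iff)
    ultimately show ?thesis
      unfolding W_def by (metis (no_types, lifting) imageI lessThan_iff)
  qed
  have dvd: "int p dvd j - k" if "u j = u k" for j k
  proof -
    have "cos (\<theta> j - \<theta> k) = 1"
      using uu [of j k] nu [of k] that by (simp add: norm_eq_1)
    then obtain n :: int where "\<theta> j - \<theta> k = of_int n * 2 * pi"
      using cos_one_2pi_int by blast
    then have "pi * (2 * of_int (j - k)) = pi * (2 * (real p * of_int n))"
      using p by (simp add: \<theta>_def field_simps)
    then have "of_int (j - k) = real p * of_int n"
      unfolding mult_cancel_left using pi_gt_zero by simp
    then have "of_int (j - k) = (of_int (int p * n) :: real)"
      by simp
    then have "j - k = int p * n"
      by (simp only: of_int_eq_iff)
    then show ?thesis
      by simp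
  qed
  have inj: "inj_on (\<lambda>k. c + r *\<^sub>R u (int k)) {..<p}"
  proof (rule inj_onI)
    fix j k assume jk: "j \<in> {..<p}" "k \<in> {..<p}" "c + r *\<^sub>R u (int j) = c + r *\<^sub>R u (int k)"
    then have "int p dvd int j - int k"
      using dvd [of "int j" "int k"] r by simp
    then show "j = k"
      using jk(1,2) by (metis int_ops(6) lessThan_iff mod_eq_dvd_iff mod_less nat_int of_nat_eq_iff zmod_int)
  qed
  have Wd: "dist c w = r" if "w \<in> W" for w
    using that nu r by (auto simp: W_def dist_norm)
  have "F \<subseteq> cball c r"
    unfolding FW using Wd by (intro hull_minimal) auto
  then have ext: "w extreme_point_of F" if "w \<in> W" for w
    unfolding extreme_point_of_def
  proof (intro conjI ballI notI)
    show "w \<in> F"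
      using that FW by (simp add: hull_inc)
    fix x y assume "x \<in> F" "y \<in> F" "w \<in> open_segment x y"
    then show False
      using dist_decreases_open_segment [of w x y c] \<open>F \<subseteq> cball c r\<close> Wd [OF that] by force
  qed
  then have V: "{v. v extreme_point_of F} = W"
    using extreme_point_of_convex_hull unfolding FW by blast
  have cardW: "card W = p"
    using card_image [OF inj] by (simp add: W_def)
  have "(\<Sum>k<p. u (int k)) = 0"
  proof -
    define \<omega> where "\<omega> = cis (2 * pi / real p)"
    have "\<omega> \<noteq> 1"
    proof
      assume "\<omega> = 1"
      then have "cos (2 * pi / real p) = 1"
        by (simp add: \<omega>_def complex_eq_iff)
      moreover have "cos (2 * pi / real p) < cos 0"
        using p by (intro cos_monotone_0_pi) (auto simp: field_simps)
      ultimately show False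
        by simp
    qed
    then have "(\<Sum>k<p. \<omega> ^ k) = (\<omega> ^ p - 1) / (\<omega> - 1)"
      by (rule geometric_sum)
    also have "\<omega> ^ p = cis (real p * (2 * pi / real p))"
      unfolding \<omega>_def by (rule Complex.DeMoivre)
    also have "real p * (2 * pi / real p) = 2 * pi"
      using p by simp
    finally have sum0: "(\<Sum>k<p. \<omega> ^ k) = 0"
      by simp
    have pow: "\<omega> ^ k = cis (\<theta> (int k))" for k
      unfolding \<omega>_def Complex.DeMoivre by (simp add: \<theta>_def mult.commute)
    have "(\<Sum>k<p. cos (\<theta> (int k))) = Re (\<Sum>k<p. \<omega> ^ k)" "(\<Sum>k<p. sin (\<theta> (int k))) = Im (\<Sum>k<p. \<omega> ^ k)"
      by (simp_all add: pow)
    then have "(\<Sum>k<p. cos (\<theta> (int k))) = 0" "(\<Sum>k<p. sin (\<theta> (int k))) = 0"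
      unfolding sum0 by simp_all
    then show ?thesis
      by (simp add: u_def sum.distrib scaleR_left.sum [symmetric])
  qed
  moreover have "(\<Sum>k<p. c) = real p *\<^sub>R c"
    by (simp only: sum_constant_scaleR card_lessThan)
  ultimately have "(\<Sum>v\<in>W. v) = real p *\<^sub>R c"
    unfolding W_def sum.reindex [OF inj] o_def sum.distrib scaleR_right.sum [symmetric] by simp
  then have cF: "centre F = c"
    using p unfolding centre_def V cardW by simp
  show "norm (v - centre F) = r" if "v extreme_point_of F" for v
  proof -
    have "v \<in> W"
      using that V by auto
    then show ?thesis
      using Wd unfolding cF by (metis dist_commute dist_norm)
  qed
  show "norm (v - w) = 2 * r * sin (pi / real p)" if e: "closed_segment v w edge_of F" for v w
  proof -
    let ?e = "closed_segment v w"
    have face: "?e face_of F" and ne: "v \<noteq> w"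
      using e by (auto simp: edge_of_def)
    have "v extreme_point_of F" "w extreme_point_of F"
      using extreme_point_of_face [OF face, of v] extreme_point_of_face [OF face, of w]
      by (simp_all add: extreme_point_of_segment)
    then have vw: "v \<in> W" "w \<in> W"
      using V by auto
    then obtain i j :: int where v: "v = c + r *\<^sub>R u i" and w: "w = c + r *\<^sub>R u j"
      unfolding W_def by auto
    have ndvd: "\<not> int p dvd i - j"
    proof
      assume "int p dvd i - j"
      then obtain n where "i - j = int p * n"
        by auto
      then have "u i = u j"
        using per [of j n] by (simp add: algebra_simps)
      then show False
        using ne v w by simp
    qed
    have W3: "\<not> W \<subseteq> ?e"
    proof
      assume "W \<subseteq> ?e"
      then have "W \<subseteq> {v, w}"
        using ext extreme_point_of_face [OF face] extreme_point_of_segment by blast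
      then have "card W \<le> card {v, w}"
        by (intro card_mono) auto
      also have "\<dots> \<le> 2"
        by (simp add: card_insert_if)
      finally show False
        using p cardW by simp
    qed
    have "?e \<noteq> F"
      using W3 FW hull_subset [of W convex] by auto
    moreover have "?e exposed_face_of F"
      using face exposed_face_of_polyhedron polytope_imp_polyhedron [OF poly] by blast
    ultimately obtain h \<beta> where h: "F \<subseteq> {x. h \<bullet> x \<le> \<beta>}" "?e = F \<inter> {x. h \<bullet> x = \<beta>}"
      unfolding exposed_face_of by auto
    have hW: "h \<bullet> x \<le> \<beta>" if "x \<in> W" for x
      using h(1) hull_inc [OF that, of convex] unfolding FW by auto
    have hv: "h \<bullet> v = \<beta>" "h \<bullet> w = \<beta>"
      using h(2) ends_in_segment [of v w] by auto
    have WF: "W \<subseteq> F"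
      unfolding FW by (rule hull_subset)
    obtain x0 where x0: "x0 \<in> W" "h \<bullet> x0 \<noteq> \<beta>"
      using W3 WF unfolding h(2) by auto
    define M where "M = sqrt ((h \<bullet> a)\<^sup>2 + (h \<bullet> b)\<^sup>2)"
    have "M \<noteq> 0"
    proof
      assume "M = 0"
      then have "h \<bullet> a = 0" "h \<bullet> b = 0"
        by (simp_all add: M_def sum_power2_eq_zero_iff)
      then have "h \<bullet> u k = 0" for k
        by (simp add: u_def inner_add_right)
      then have "h \<bullet> x = h \<bullet> c" if "x \<in> W" for x
        using that by (auto simp: W_def inner_add_right)
      then show False
        using x0 hv(1) vw(1) by metis
    qed
    then have M: "M > 0"
      by (simp add: M_def less_le)
    have M2: "(h \<bullet> a)\<^sup>2 + (h \<bullet> b)\<^sup>2 = M\<^sup>2"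
      by (simp add: M_def)
    have "((h \<bullet> a) / M)\<^sup>2 + ((h \<bullet> b) / M)\<^sup>2 = ((h \<bullet> a)\<^sup>2 + (h \<bullet> b)\<^sup>2) / M\<^sup>2"
      by (simp add: power_divide add_divide_distrib)
    also have "\<dots> = 1"
      unfolding M2 using M by simp
    finally obtain \<phi> where \<phi>: "(h \<bullet> a) / M = cos \<phi>" "(h \<bullet> b) / M = sin \<phi>"
      using sincos_total_2pi by metis
    then have "h \<bullet> a = M * cos \<phi>" "h \<bullet> b = M * sin \<phi>"
      using M by (simp_all add: field_simps)
    then have hu: "h \<bullet> u k = M * cos (\<theta> k - \<phi>)" for k
      by (simp add: u_def inner_add_right cos_diff algebra_simps)
    have "h \<bullet> c + r * (h \<bullet> u k) \<le> h \<bullet> c + r * (h \<bullet> u i)" "h \<bullet> c + r * (h \<bullet> u i) = h \<bullet> c + r * (h \<bullet> u j)" for k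
      using hW [OF uW [of k]] hv by (simp_all add: v w inner_add_right)
    then have "h \<bullet> u k \<le> h \<bullet> u i" "h \<bullet> u i = h \<bullet> u j" for k
      using r by simp_all
    then have cmax: "cos (\<theta> k - \<phi>) \<le> cos (\<theta> i - \<phi>)" "cos (\<theta> i - \<phi>) = cos (\<theta> j - \<phi>)" for k
      unfolding hu using M by (simp_all add: mult_le_cancel_left_pos)
    \<comment> \<open>The maximum is attained at two vertices, so that its direction \<open>\<phi>\<close> bisects them:
      \<open>2 * \<phi>\<close> is the sum of their angles, up to a full turn absorbed into \<open>l\<close>.\<close>
    obtain n :: int where n: "\<theta> i - \<phi> = - (\<theta> j - \<phi>) + 2 * of_int n * pi"
    proof -
      obtain m where m: "m \<in> \<int>" "\<theta> i - \<phi> = \<theta> j - \<phi> + 2 * m * pi \<or> \<theta> i - \<phi> = - (\<theta> j - \<phi>) + 2 * m * pi"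
        using cmax(2) unfolding cos_eq by blast
      then obtain n :: int where n: "m = of_int n"
        by (auto elim: Ints_cases)
      have "\<theta> i - \<phi> \<noteq> \<theta> j - \<phi> + 2 * m * pi"
      proof
        assume "\<theta> i - \<phi> = \<theta> j - \<phi> + 2 * m * pi"
        then have "\<theta> i = \<theta> j + 2 * pi * of_int n"
          by (simp add: n)
        then have "u i = u j"
          by (simp add: u_def cos_add sin_add)
        then show False
          using ne v w by simp
      qed
      then show thesis
        using m(2) n that by blast
    qed
    define l where "l = j - int p * n"
    have \<phi>': "\<phi> = pi * of_int (i + l) / real p"
      using n p by (simp add: \<theta>_def l_def field_simps)
    have \<theta>\<phi>: "\<theta> k - \<phi> = pi * of_int (2 * k - i - l) / real p" for k
      using p by (simp add: \<phi>' \<theta>_def field_simps)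
    define k where "k = (i + l + 1) div 2"
    have k01: "2 * k - i - l = 0 \<or> 2 * k - i - l = 1"
      unfolding k_def by presburger
    have "cos (pi / real p) \<le> cos (\<theta> k - \<phi>)"
      unfolding \<theta>\<phi> using k01
      by (elim disjE) (simp_all only: of_int_0 of_int_1 mult_zero_right mult_1_right div_0 cos_zero cos_le_one order_refl)
    also have "\<dots> \<le> cos (pi * of_int (i - l) / real p)"
      using cmax(1) [of k] \<theta>\<phi> [of i] by simp
    finally have "cos (pi / real p) \<le> cos (pi * of_int (i - l) / real p)" .
    moreover have "\<not> int p dvd i - l"
    proof
      assume "int p dvd i - l"
      then have "int p dvd (i - l) - int p * n"
        by (simp add: dvd_diff)
      then show False
        using ndvd by (simp add: l_def)
    qed
    ultimately have s2: "(sin (pi * of_int (i - l) / real p))\<^sup>2 = (sin (pi / real p))\<^sup>2"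
      using p by (intro cos_ge_cos_step) auto
    have "u l = u j"
      using per [of l n] by (simp add: l_def)
    then have "(norm (v - w))\<^sup>2 = (norm (r *\<^sub>R (u i - u l)))\<^sup>2"
      by (simp add: v w scaleR_diff_right)
    also have "\<dots> = r\<^sup>2 * ((u i - u l) \<bullet> (u i - u l))"
      by (simp add: power_mult_distrib power2_norm_eq_inner)
    also have "(u i - u l) \<bullet> (u i - u l) = 2 - 2 * cos (\<theta> i - \<theta> l)"
      using nu [of i] nu [of l] uu [of i l]
      by (simp add: inner_diff_left inner_diff_right norm_eq_1 inner_commute)
    also have "\<theta> i - \<theta> l = 2 * (pi * of_int (i - l) / real p)"
      by (simp add: \<theta>_def diff_divide_distrib [symmetric] algebra_simps)
    also have "2 - 2 * cos (2 * (pi * of_int (i - l) / real p)) = 4 * (sin (pi * of_int (i - l) / real p))\<^sup>2"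
      by (simp only: cos_double_sin) simp
    finally have "(norm (v - w))\<^sup>2 = (2 * r * sin (pi / real p))\<^sup>2"
      unfolding s2 by (simp add: power_mult_distrib)
    moreover have "0 \<le> 2 * r * sin (pi / real p)"
      using r p by (intro mult_nonneg_nonneg sin_ge_zero) (auto simp: field_simps)
    ultimately show ?thesis
      by (simp add: power2_eq_iff_nonneg)
  qed
qed

section \<open>The flags of a Platonic solid\<close>

lemma sgn_hull_triple_scale:
  fixes a b c :: "real^3"
  assumes "0 \<notin> convex hull {a, b, c}" "0 \<notin> convex hull {a, s *\<^sub>R b, t *\<^sub>R c}" and st: "0 < s" "0 < t"
  shows "sgn ` (convex hull {a, s *\<^sub>R b, t *\<^sub>R c}) = sgn ` (convex hull {a, b, c})"
proof -
  have "(\<exists>k l m. 0 \<le> k \<and> 0 \<le> l \<and> 0 \<le> m \<and> x = k *\<^sub>R a + l *\<^sub>R s *\<^sub>R b + m *\<^sub>R t *\<^sub>R c) \<longleftrightarrow>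
      (\<exists>k l m. 0 \<le> k \<and> 0 \<le> l \<and> 0 \<le> m \<and> x = k *\<^sub>R a + l *\<^sub>R b + m *\<^sub>R c)" for x
  proof
    assume "\<exists>k l m. 0 \<le> k \<and> 0 \<le> l \<and> 0 \<le> m \<and> x = k *\<^sub>R a + l *\<^sub>R s *\<^sub>R b + m *\<^sub>R t *\<^sub>R c"
    then obtain k l m where "0 \<le> k" "0 \<le> l" "0 \<le> m" "x = k *\<^sub>R a + l *\<^sub>R s *\<^sub>R b + m *\<^sub>R t *\<^sub>R c"
      by blast
    then have "0 \<le> k \<and> 0 \<le> l * s \<and> 0 \<le> m * t \<and> x = k *\<^sub>R a + (l * s) *\<^sub>R b + (m * t) *\<^sub>R c"
      using st by simp
    then show "\<exists>k l m. 0 \<le> k \<and> 0 \<le> l \<and> 0 \<le> m \<and> x = k *\<^sub>R a + l *\<^sub>R b + m *\<^sub>R c"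
      by blast
  next
    assume "\<exists>k l m. 0 \<le> k \<and> 0 \<le> l \<and> 0 \<le> m \<and> x = k *\<^sub>R a + l *\<^sub>R b + m *\<^sub>R c"
    then obtain k l m where "0 \<le> k" "0 \<le> l" "0 \<le> m" "x = k *\<^sub>R a + l *\<^sub>R b + m *\<^sub>R c"
      by blast
    then have "0 \<le> k \<and> 0 \<le> l / s \<and> 0 \<le> m / t \<and> x = k *\<^sub>R a + (l / s) *\<^sub>R s *\<^sub>R b + (m / t) *\<^sub>R t *\<^sub>R c"
      using st by simp
    then show "\<exists>k l m. 0 \<le> k \<and> 0 \<le> l \<and> 0 \<le> m \<and> x = k *\<^sub>R a + l *\<^sub>R s *\<^sub>R b + m *\<^sub>R t *\<^sub>R c"
      by blast
  qed
  then show ?thesis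
    unfolding sgn_hull_eq_cone [OF assms(1)] sgn_hull_eq_cone [OF assms(2)] by simp
qed

lemma open_segment_crossing:
  fixes a b n :: "real^3"
  assumes "n \<bullet> a < t" "t < n \<bullet> b"
  obtains z where "z \<in> open_segment a b" "n \<bullet> z = t"
proof -
  define u where "u = (t - n \<bullet> a) / (n \<bullet> b - n \<bullet> a)"
  have "0 < u" "u < 1"
    using assms by (simp_all add: u_def)
  moreover have "n \<bullet> ((1 - u) *\<^sub>R a + u *\<^sub>R b) = n \<bullet> a + u * (n \<bullet> b - n \<bullet> a)"
    by (simp add: inner_add_right algebra_simps)
  then have "n \<bullet> ((1 - u) *\<^sub>R a + u *\<^sub>R b) = t"
    using assms by (simp add: u_def)
  moreover have "a \<noteq> b"
    using assms by auto
  ultimately show thesis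
    using that [of "(1 - u) *\<^sub>R a + u *\<^sub>R b"] by (auto simp: in_segment)
qed

text \<open>A Platonic solid in the unit sphere, together with the common circumradius \<open>r\<close> of its faces.\<close>

locale inscribed_solid =
  fixes p q :: nat and r :: real and P :: "(real^3) set"
  assumes polytope: "polytope P" and dim: "aff_dim P = 3"
    and facets: "\<And>F. F facet_of P \<Longrightarrow> regular_polygon p r F"
    and vertices: "\<And>v. v extreme_point_of P \<Longrightarrow> card {F. F facet_of P \<and> v \<in> F} = q"
    and centred: "centre P = 0"
    and inscribed: "\<And>v. v extreme_point_of P \<Longrightarrow> norm v = 1"
begin

text \<open>The squared distances from the origin of the centres of the faces (\<open>\<delta>\<close>) and of the midpoints
of the edges (\<open>\<mu>\<close>). That they are the same for all faces and edges is what the inscription in a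
sphere buys.\<close>

definition \<delta> :: real where "\<delta> = 1 - r\<^sup>2"

definition \<mu> :: real where "\<mu> = 1 - r\<^sup>2 * (sin (pi / real p))\<^sup>2"

definition flag :: "real^3 \<Rightarrow> (real^3) set \<Rightarrow> (real^3) set \<Rightarrow> bool"
  where "flag v e F \<longleftrightarrow> F facet_of P \<and> e edge_of F \<and> v extreme_point_of e"

definition flags :: "chamber set"
  where "flags = {(v, sgn (centre e), sgn (centre F)) | v e F. flag v e F}"

lemma zero_in_interior: "0 \<in> interior P"
proof -
  have "P \<noteq> {}"
    using dim by auto
  then have "0 \<in> rel_interior P"
    using centre_in_rel_interior [OF polytope] centred by simp
  moreover have "affine hull P = UNIV"
    using dim by (simp add: aff_dim_eq_full [symmetric])
  ultimately show ?thesis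
    by (simp add: rel_interior_interior)
qed

lemma facet_face:
  assumes "F facet_of P"
  shows "F face_of P" "F \<noteq> {}" "F \<noteq> P" "polytope F" "convex F" "aff_dim F = 2" "0 \<notin> F"
proof -
  show F: "F face_of P" "F \<noteq> {}" "F \<noteq> P" and "aff_dim F = 2"
    using assms dim by (auto simp: facet_of_def)
  show "polytope F"
    using face_of_polytope_polytope [OF polytope F(1)] .
  then show "convex F"
    by (rule polytope_imp_convex)
  show "0 \<notin> F"
    using face_of_disjoint_interior [OF F(1,3)] zero_in_interior by blast
qed

lemma centre_in_facet: "F facet_of P \<Longrightarrow> centre F \<in> rel_interior F" "F facet_of P \<Longrightarrow> centre F \<in> F"
  using centre_in_rel_interior [OF facet_face(4,2)] rel_interior_subset by blast+

lemma facet_vertex: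
  assumes "F facet_of P"
  shows "v extreme_point_of F \<longleftrightarrow> v extreme_point_of P \<and> v \<in> F"
  by (rule extreme_point_of_face [OF facet_face(1) [OF assms]])

text \<open>The vertices of \<open>F\<close> have norm \<open>1\<close> and distance \<open>r\<close> from the centre of \<open>F\<close>, hence the same
inner product with it. So the plane of \<open>F\<close> is perpendicular to the centre of \<open>F\<close>.\<close>

lemma facet_plane:
  assumes F: "F facet_of P" and "x \<in> F"
  shows "centre F \<bullet> x = \<delta>"
proof -
  define c where "c = centre F"
  define \<kappa> where "\<kappa> = (1 + c \<bullet> c - r\<^sup>2) / 2"
  have "c \<bullet> v = \<kappa>" if "v extreme_point_of F" for v
  proof -
    have "norm v = 1"
      using that facet_vertex [OF F] inscribed by blast
    have "(v - c) \<bullet> (v - c) = r\<^sup>2"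
      using regular_polygon_metric(3) [OF facets [OF F] that] power2_norm_eq_inner [of "v - c"]
      by (simp add: c_def)
    then have "v \<bullet> v - 2 * (c \<bullet> v) + c \<bullet> c = r\<^sup>2"
      by (simp add: inner_diff_left inner_diff_right inner_commute)
    then show ?thesis
      using \<open>norm v = 1\<close> by (simp add: \<kappa>_def norm_eq_1)
  qed
  then have "convex hull {v. v extreme_point_of F} \<subseteq> {x. c \<bullet> x = \<kappa>}"
    by (intro hull_minimal) (auto simp: convex_hyperplane)
  then have all: "c \<bullet> y = \<kappa>" if "y \<in> F" for y
    using polytope_hull_extreme_points [OF facet_face(4) [OF F]] that by auto
  have "c \<bullet> c = \<kappa>"
    using all centre_in_facet(2) [OF F] by (simp add: c_def)
  then have "\<kappa> = \<delta>"
    by (simp add: \<kappa>_def \<delta>_def field_simps)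
  then show ?thesis
    using all [OF assms(2)] by (simp add: c_def)
qed

lemma facet_centre_norm:
  assumes "F facet_of P"
  shows "centre F \<bullet> centre F = \<delta>" "0 < \<delta>"
proof -
  show c: "centre F \<bullet> centre F = \<delta>"
    using facet_plane [OF assms centre_in_facet(2) [OF assms]] .
  have "centre F \<noteq> 0"
    using centre_in_facet(2) [OF assms] facet_face(7) [OF assms] by auto
  then show "0 < \<delta>"
    unfolding c [symmetric] by simp
qed

lemma facet_exists: obtains F where "F facet_of P"
  using polytope_facet_exists [OF polytope] dim by auto

lemma parameters: "3 \<le> p" "0 < r" "0 < \<delta>" "\<delta> < \<mu>" "\<mu> < 1" "0 < \<mu>"
proof -
  obtain F where F: "F facet_of P"
    by (rule facet_exists)
  show p: "3 \<le> p" and r: "0 < r"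
    using regular_polygon_metric(1,2) [OF facets [OF F]] by auto
  show "0 < \<delta>"
    by (rule facet_centre_norm(2) [OF F])
  have "pi / real p < pi / 2"
    using p by (intro divide_strict_left_mono) auto
  then have sin: "0 < sin (pi / real p)" and cos: "0 < cos (pi / real p)"
    using p by (auto intro!: sin_gt_zero cos_gt_zero simp: field_simps)
  then show "\<mu> < 1"
    using r by (simp add: \<mu>_def)
  have "(sin (pi / real p))\<^sup>2 < 1"
    using cos by (simp add: sin_squared_eq)
  then show "\<delta> < \<mu>"
    using r by (simp add: \<mu>_def \<delta>_def)
  with \<open>0 < \<delta>\<close> show "0 < \<mu>"
    by simp
qed

text \<open>The segment from the origin to a point of the solid beyond the plane of \<open>F\<close> would cross \<open>F\<close> in
an inner point of the segment, so that the face \<open>F\<close> would contain the origin.\<close>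

lemma facet_supports:
  assumes F: "F facet_of P" and "y \<in> P"
  shows "centre F \<bullet> y \<le> \<delta>"
proof (rule ccontr)
  assume "\<not> centre F \<bullet> y \<le> \<delta>"
  then obtain z where z: "z \<in> open_segment 0 y" "centre F \<bullet> z = \<delta>"
    using open_segment_crossing [of "centre F" 0 \<delta> y] parameters(3) by auto
  have "0 \<in> P"
    using zero_in_interior interior_subset by blast
  have "affine hull F \<subseteq> {x. centre F \<bullet> x = \<delta>}"
    using facet_plane [OF F] by (intro hull_minimal) (auto simp: affine_hyperplane)
  moreover have "centre F \<noteq> 0"
    using facet_centre_norm [OF F] by auto
  then have "aff_dim (affine hull F) = aff_dim {x. centre F \<bullet> x = \<delta>}"
    using facet_face(6) [OF F] by (simp add: aff_dim_hyperplane)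
  ultimately have "affine hull F = {x. centre F \<bullet> x = \<delta>}"
    using facet_face(2) [OF F] by (intro affine_dim_equal) (auto simp: affine_hyperplane)
  moreover have "z \<in> P"
    using z(1) \<open>0 \<in> P\<close> assms(2) polytope_imp_convex [OF polytope]
    by (meson convex_contains_open_segment subsetD)
  ultimately have "z \<in> F"
    using face_of_imp_eq_affine_Int [OF polytope_imp_convex [OF polytope] facet_face(1) [OF F]] z(2) by blast
  then have "0 \<in> F"
    using face_ofD [OF facet_face(1) [OF F] z(1) \<open>0 \<in> P\<close> assms(2)] by blast
  then show False
    using facet_face(7) [OF F] by blast
qed

lemma facet_eq_if_centre_eq:
  "F facet_of P \<Longrightarrow> G facet_of P \<Longrightarrow> centre F = centre G \<Longrightarrow> F = G"
  using face_eq_if_centre_eq [OF polytope] facet_face by blast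

lemma edge_is_facet:
  assumes "F facet_of P"
  shows "e edge_of F \<longleftrightarrow> e facet_of F"
  using facet_face(6) [OF assms] by (auto simp: edge_of_def facet_of_def)

lemma facet_edge:
  assumes F: "F facet_of P" and e: "e edge_of F"
  obtains v w where "v \<noteq> w" "e = closed_segment v w" "{v. v extreme_point_of e} = {v, w}"
    "centre e = (1/2) *\<^sub>R (v + w)" "norm v = 1" "norm w = 1" "v \<bullet> centre e = \<mu>" "w \<bullet> centre e = \<mu>"
    "centre e \<bullet> centre e = \<mu>"
proof -
  obtain v w where vw: "v \<noteq> w" "e = closed_segment v w" "{v. v extreme_point_of e} = {v, w}"
    "centre e = (1/2) *\<^sub>R (v + w)"
    by (rule edge_endpoints [OF facet_face(4) [OF F] e])
  have "v extreme_point_of e" "w extreme_point_of e"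
    using vw(3) by auto
  moreover have "e face_of F"
    using e by (simp add: edge_of_def)
  ultimately have "v extreme_point_of P" "w extreme_point_of P"
    using extreme_point_of_face facet_vertex [OF F] by blast+
  then have n: "norm v = 1" "norm w = 1"
    by (simp_all add: inscribed)
  have "norm (v - w) = 2 * r * sin (pi / real p)"
    using regular_polygon_metric(4) [OF facets [OF F]] e vw(2) by blast
  then have "(norm (v - w))\<^sup>2 = 4 * (r\<^sup>2 * (sin (pi / real p))\<^sup>2)"
    by (simp add: power_mult_distrib)
  then have "4 * (r\<^sup>2 * (sin (pi / real p))\<^sup>2) = 2 - 2 * (v \<bullet> w)"
    using n by (simp add: power2_norm_eq_inner inner_diff_left inner_diff_right inner_commute norm_eq_1)
  then have ip: "v \<bullet> w = 2 * \<mu> - 1" "w \<bullet> v = 2 * \<mu> - 1"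
    by (simp_all add: \<mu>_def inner_commute)
  have vm: "v \<bullet> centre e = \<mu>" "w \<bullet> centre e = \<mu>"
    using n by (simp_all add: vw(4) inner_add_right ip norm_eq_1)
  have "centre e \<bullet> centre e = (1/2) * (v \<bullet> centre e + w \<bullet> centre e)"
    by (subst vw(4)) (simp add: inner_add_left)
  then have "centre e \<bullet> centre e = \<mu>"
    by (simp add: vm)
  then show thesis
    using that vw n vm by blast
qed

lemma flag_products:
  assumes "flag v e F"
  shows "v \<in> P" "centre e \<in> F" "centre e \<in> P" "norm v = 1" "v \<bullet> centre e = \<mu>" "centre e \<bullet> centre e = \<mu>"
    "v \<bullet> centre F = \<delta>" "centre e \<bullet> centre F = \<delta>" "centre F \<bullet> centre F = \<delta>" "v \<in> e" "v \<in> F"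
    "v extreme_point_of F" "v extreme_point_of P" "centre e \<in> e"
proof -
  have F: "F facet_of P" and e: "e edge_of F" and v: "v extreme_point_of e"
    using assms by (auto simp: flag_def)
  have ef: "e face_of F"
    using e by (simp add: edge_of_def)
  then have sub: "e \<subseteq> F"
    by (rule face_of_imp_subset)
  have FP: "F \<subseteq> P"
    using facet_face(1) [OF F] by (rule face_of_imp_subset)
  obtain a b where ab: "{v. v extreme_point_of e} = {a, b}" "norm a = 1" "norm b = 1"
    "a \<bullet> centre e = \<mu>" "b \<bullet> centre e = \<mu>" "centre e \<bullet> centre e = \<mu>"
    by (rule facet_edge [OF F e])
  have "v = a \<or> v = b"
    using ab(1) v by blast
  then show "norm v = 1" "v \<bullet> centre e = \<mu>"
    using ab by auto
  show "centre e \<bullet> centre e = \<mu>"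
    by (fact ab)
  show ve: "v \<in> e"
    using v by (simp add: extreme_point_of_def)
  show vF: "v \<in> F"
    using ve sub by blast
  show "v \<in> P"
    using vF FP by blast
  have "polytope e" "e \<noteq> {}"
    using face_of_polytope_polytope [OF facet_face(4) [OF F] ef] ve by auto
  then show me: "centre e \<in> e"
    using centre_in_rel_interior rel_interior_subset by blast
  show mF: "centre e \<in> F"
    using me sub by blast
  show "centre e \<in> P"
    using mF FP by blast
  show "v \<bullet> centre F = \<delta>" "centre e \<bullet> centre F = \<delta>" "centre F \<bullet> centre F = \<delta>"
    using facet_plane [OF F vF] facet_plane [OF F mF] facet_centre_norm [OF F] by (simp_all add: inner_commute)
  show "v extreme_point_of F"
    using extreme_point_of_face [OF ef] v by blast
  then show "v extreme_point_of P"
    using facet_vertex [OF F] by blast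
qed

text \<open>The argument of \<open>facet_supports\<close> inside the plane of \<open>F\<close> and with the centre of \<open>F\<close> in the
place of the origin.\<close>

lemma edge_supports:
  assumes fl: "flag v e F" and "y \<in> F"
  shows "(centre e - centre F) \<bullet> y \<le> \<mu> - \<delta>"
proof (rule ccontr)
  define m c where "m = centre e" and "c = centre F"
  assume "\<not> (centre e - centre F) \<bullet> y \<le> \<mu> - \<delta>"
  then have less: "\<mu> - \<delta> < (m - c) \<bullet> y"
    by (simp add: m_def c_def)
  have F: "F facet_of P" and e: "e face_of F"
    using fl by (auto simp: flag_def edge_of_def)
  note g = flag_products [OF fl, folded m_def c_def]
  have cF: "c \<in> F"
    using centre_in_facet(2) [OF F] by (simp add: c_def)
  have mc: "(m - c) \<bullet> c = 0"
    using g by (simp add: inner_diff_left)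
  obtain z where z: "z \<in> open_segment c y" "(m - c) \<bullet> z = \<mu> - \<delta>"
    using open_segment_crossing [of "m - c" c "\<mu> - \<delta>" y] less parameters(4) mc by auto
  have zF: "z \<in> F"
    using z(1) cF assms(2) facet_face(5) [OF F] by (metis convex_contains_open_segment subsetD)
  \<comment> \<open>\<open>c\<close>, \<open>m - c\<close> and \<open>v - m\<close> are orthogonal, and \<open>z - m\<close> is perpendicular to the first two.\<close>
  have sq: "c \<bullet> m = \<delta>" "c \<bullet> v = \<delta>" "m \<bullet> v = \<mu>" "v \<bullet> v = 1"
    using g by (simp_all add: inner_commute norm_eq_1)
  have "c \<noteq> 0" "m - c \<noteq> 0" "v - m \<noteq> 0"
    using g sq parameters(3-5) by (auto simp: inner_commute)
  moreover have "c \<bullet> (m - c) = 0" "(m - c) \<bullet> (v - m) = 0" "c \<bullet> (v - m) = 0"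
    using g sq by (simp_all add: inner_diff_left inner_diff_right inner_commute)
  ultimately have "z - m = ((z - m) \<bullet> sgn c) *\<^sub>R sgn c + ((z - m) \<bullet> sgn (m - c)) *\<^sub>R sgn (m - c)
      + ((z - m) \<bullet> sgn (v - m)) *\<^sub>R sgn (v - m)"
    by (intro orthonormal_expansion) (auto simp: norm_sgn sgn_div_norm)
  moreover have zc: "c \<bullet> z = \<delta>"
    using facet_plane [OF F zF] by (simp add: c_def)
  then have "(z - m) \<bullet> c = 0"
    using g by (simp add: inner_diff_left inner_commute [of z])
  moreover have "m \<bullet> z = \<mu>"
    using z(2) zc by (simp add: inner_diff_left)
  then have "(z - m) \<bullet> (m - c) = 0"
    using zc g by (simp add: inner_diff_left inner_diff_right inner_commute [of z])
  ultimately have "z - m = ((z - m) \<bullet> sgn (v - m) / norm (v - m)) *\<^sub>R (v - m)"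
    by (simp add: sgn_div_norm divide_inverse)
  then obtain t where t: "z - m = t *\<^sub>R (v - m)"
    by blast
  then have "z = (1 - t) *\<^sub>R m + t *\<^sub>R v"
    by (simp add: algebra_simps)
  moreover have "m \<in> affine hull e" "v \<in> affine hull e"
    using g by (simp_all add: hull_inc)
  ultimately have "z \<in> affine hull e"
    using mem_affine [OF affine_affine_hull, of m e v "1 - t" t] by simp
  then have "z \<in> e"
    using face_of_imp_eq_affine_Int [OF facet_face(5) [OF F] e] zF by blast
  then have "c \<in> e"
    using face_ofD [OF e z(1) cF assms(2)] by blast
  moreover have "e \<noteq> F"
    using fl facet_face(6) [OF F] by (auto simp: flag_def edge_of_def)
  then have "e \<inter> rel_interior F = {}"
    by (rule face_of_disjoint_rel_interior [OF e])
  ultimately show False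
    using centre_in_facet(1) [OF F] by (auto simp: c_def)
qed

end

context inscribed_solid
begin

text \<open>The legs of the tiles are the arcs that join the midpoint of an edge to a vertex and to the
centre of a face.\<close>

definition "cos_vertex_leg = sqrt \<mu>"
definition "cos_face_leg = sqrt (\<delta> / \<mu>)"

lemma legs_range: "0 < cos_vertex_leg" "cos_vertex_leg < 1" "0 < cos_face_leg" "cos_face_leg < 1"
  using parameters by (simp_all add: cos_vertex_leg_def cos_face_leg_def)

lemma legs_square: "cos_vertex_leg\<^sup>2 = \<mu>" "cos_face_leg\<^sup>2 = \<delta> / \<mu>" "cos_vertex_leg * cos_face_leg = sqrt \<delta>"
  using parameters by (simp_all add: cos_vertex_leg_def cos_face_leg_def real_sqrt_mult [symmetric])

lemma flag_sgn:
  assumes "flag v e F"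
  shows "sgn (centre e) = (1 / sqrt \<mu>) *\<^sub>R centre e" "sgn (centre F) = (1 / sqrt \<delta>) *\<^sub>R centre F"
proof -
  have "norm (centre e) = sqrt \<mu>" "norm (centre F) = sqrt \<delta>"
    unfolding norm_eq_sqrt_inner using flag_products(6,9) [OF assms] by simp_all
  then show "sgn (centre e) = (1 / sqrt \<mu>) *\<^sub>R centre e" "sgn (centre F) = (1 / sqrt \<delta>) *\<^sub>R centre F"
    by (simp_all add: sgn_div_norm divide_inverse)
qed

lemma flag_right_triple:
  assumes "flag v e F"
  shows "right_triple cos_vertex_leg cos_face_leg v (sgn (centre e)) (sgn (centre F))"
proof -
  note g = flag_products [OF assms]
  have nz: "centre e \<noteq> 0" "centre F \<noteq> 0"
    using g(6,9) parameters by auto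
  have "v \<bullet> sgn (centre e) = cos_vertex_leg"
    using g parameters by (simp add: flag_sgn(1) [OF assms] cos_vertex_leg_def real_div_sqrt)
  moreover have "sgn (centre e) \<bullet> sgn (centre F) = cos_face_leg"
  proof -
    have "sgn (centre e) \<bullet> sgn (centre F) = \<delta> / sqrt \<delta> / sqrt \<mu>"
      using g by (simp add: flag_sgn [OF assms])
    then show ?thesis
      using parameters by (simp add: real_div_sqrt cos_face_leg_def real_sqrt_divide)
  qed
  moreover have "v \<bullet> sgn (centre F) = cos_vertex_leg * cos_face_leg"
    unfolding legs_square using g parameters by (simp add: flag_sgn(2) [OF assms] real_div_sqrt)
  ultimately show ?thesis
    unfolding right_triple_def using g(4) nz by (simp add: norm_sgn)
qed

lemma flag_sgn_eq:
  assumes "flag v e F" "flag v' e' F'"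
  shows "sgn (centre e) = sgn (centre e') \<longleftrightarrow> centre e = centre e'"
    "sgn (centre F) = sgn (centre F') \<longleftrightarrow> centre F = centre F'"
  using parameters by (simp_all add: flag_sgn [OF assms(1)] flag_sgn [OF assms(2)])

lemma flag_in_flags: "flag v e F \<Longrightarrow> (v, sgn (centre e), sgn (centre F)) \<in> flags"
  by (auto simp: flags_def)

lemma in_flagsE:
  assumes "(a, b, c) \<in> flags"
  obtains e F where "flag a e F" "b = sgn (centre e)" "c = sgn (centre F)"
  using assms by (auto simp: flags_def)

subsection \<open>Adjacent flags\<close>

lemma other_end:
  assumes "flag v e F"
  obtains w where "w \<noteq> v" "flag w e F"
proof -
  have F: "F facet_of P" and e: "e edge_of F" and v: "v extreme_point_of e"
    using assms by (auto simp: flag_def)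
  obtain a b where ab: "a \<noteq> b" "{v. v extreme_point_of e} = {a, b}"
    by (rule facet_edge [OF F e])
  have "v = a \<or> v = b"
    using ab(2) v by blast
  then obtain w where "w \<noteq> v" "w \<in> {a, b}"
    using ab(1) by auto
  moreover have "w extreme_point_of e"
    using \<open>w \<in> {a, b}\<close> ab(2) by blast
  ultimately show thesis
    using that F e by (simp add: flag_def)
qed

lemma vertex_edge:
  assumes F: "F facet_of P" and v: "v extreme_point_of F"
  obtains e where "flag v e F"
proof -
  have vF: "{v} face_of F"
    using v by (simp add: face_of_singleton)
  moreover have "{v} \<noteq> F"
    using facet_face(6) [OF F] by auto
  ultimately obtain e where e: "e facet_of F" "{v} \<subseteq> e"
    using face_of_polyhedron_subset_facet [OF polytope_imp_polyhedron [OF facet_face(4) [OF F]] vF] by blast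
  then have "v extreme_point_of e"
    using extreme_point_of_face [OF facet_of_imp_face_of [OF e(1)]] v by blast
  then show thesis
    using that F e(1) edge_is_facet [OF F] by (simp add: flag_def)
qed

lemma other_edge:
  assumes "flag v e F"
  obtains e' where "centre e' \<noteq> centre e" "flag v e' F"
proof -
  have F: "F facet_of P" and e: "e facet_of F" and v: "v extreme_point_of e"
    using assms edge_is_facet by (auto simp: flag_def)
  note g = flag_products [OF assms]
  have vF: "{v} face_of F"
    using g(12) by (simp add: face_of_singleton)
  have "{v} \<noteq> e"
    using e facet_face(6) [OF F] by (auto simp: facet_of_def)
  then obtain e' where e': "e' facet_of F" "e' \<noteq> e" "{v} \<subseteq> e'"
    using face_in_second_facet [OF facet_face(4) [OF F] vF _ e] g(10) by auto
  have "v extreme_point_of e'"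
    using extreme_point_of_face [OF facet_of_imp_face_of [OF e'(1)]] g(12) e'(3) by blast
  then have "flag v e' F"
    using F e'(1) edge_is_facet [OF F] by (simp add: flag_def)
  moreover have "centre e' \<noteq> centre e"
    using face_eq_if_centre_eq [OF facet_face(4) [OF F]] e e' by (auto simp: facet_of_def)
  ultimately show thesis
    using that by blast
qed

lemma other_facet:
  assumes "flag v e F"
  obtains G where "centre G \<noteq> centre F" "flag v e G"
proof -
  have F: "F facet_of P" and e: "e edge_of F" and v: "v extreme_point_of e"
    using assms by (auto simp: flag_def)
  have eF: "e face_of F" "aff_dim e = 1"
    using e by (auto simp: edge_of_def)
  have eP: "e face_of P"
    using face_of_trans [OF eF(1) facet_face(1) [OF F]] .
  have "e \<noteq> F" "e \<noteq> {}"
    using facet_face(6) [OF F] eF(2) by auto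
  then obtain G where G: "G facet_of P" "G \<noteq> F" "e \<subseteq> G"
    using face_in_second_facet [OF polytope eP _ F] face_of_imp_subset [OF eF(1)] by blast
  have "e face_of G"
    using face_of_subset [OF eP G(3)] facet_of_imp_subset [OF G(1)] by blast
  then have "flag v e G"
    using G(1) eF(2) v by (simp add: flag_def edge_of_def)
  moreover have "centre G \<noteq> centre F"
    using facet_eq_if_centre_eq [OF G(1) F] G(2) by blast
  ultimately show thesis
    using that by blast
qed

subsection \<open>Connectedness\<close>

text \<open>The edges of a face are reached one from another through common vertices, and the faces through
common edges; both are instances of the connectedness of the facets of a polytope.\<close>

lemma flags_connected:
  assumes R: "R \<subseteq> flags" "R \<noteq> {}" "closed_under_adjacency flags R"
  shows "R = flags"
proof -
  have move: "(a, b, c) \<in> R \<Longrightarrow> (d, b, c) \<in> flags \<Longrightarrow> (d, b, c) \<in> R"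
    "(a, b, c) \<in> R \<Longrightarrow> (a, d, c) \<in> flags \<Longrightarrow> (a, d, c) \<in> R"
    "(a, b, c) \<in> R \<Longrightarrow> (a, b, d) \<in> flags \<Longrightarrow> (a, b, d) \<in> R" for a b c d
    using R(3) unfolding closed_under_adjacency_def by blast+
  define reached where "reached = (\<lambda>v e F. (v, sgn (centre e), sgn (centre F)) \<in> R)"
  have vertices: "reached w e F" if "reached v e F" "flag w e F" for v w e F
    using move(1) that flag_in_flags unfolding reached_def by blast
  have edges: "reached w e' F" if "flag v e F" "reached v e F" "flag w e' F" for v w e e' F
  proof -
    have F: "F facet_of P"
      using that(1) by (simp add: flag_def)
    define C where "C = {e. e facet_of F \<and> (\<forall>v. flag v e F \<longrightarrow> reached v e F)}"
    have "C = {e. e facet_of F}"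
    proof (rule facets_connected [OF facet_face(4) [OF F]])
      show "aff_dim F = 2 \<or> aff_dim F = 3"
        using facet_face(6) [OF F] by simp
      show "C \<subseteq> {e. e facet_of F}"
        by (auto simp: C_def)
      show "e \<in> C"
        using that(1,2) vertices edge_is_facet [OF F] by (auto simp: C_def flag_def)
      fix e1 e2 assume e1: "e1 \<in> C" and e2: "e2 facet_of F" and "aff_dim (e1 \<inter> e2) = aff_dim F - 2"
      then have "aff_dim (e1 \<inter> e2) = 0"
        using facet_face(6) [OF F] by simp
      then obtain u where u: "e1 \<inter> e2 = {u}"
        using aff_dim_eq_0 by blast
      have f1: "e1 facet_of F"
        using e1 by (simp add: C_def)
      have "{u} face_of F"
        using face_of_Int [OF facet_of_imp_face_of [OF f1] facet_of_imp_face_of [OF e2]] u by simp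
      then have "u extreme_point_of F"
        by (simp add: face_of_singleton)
      moreover have "u \<in> e1" "u \<in> e2"
        using u by auto
      ultimately have "u extreme_point_of e1" "u extreme_point_of e2"
        using extreme_point_of_face facet_of_imp_face_of f1 e2 by blast+
      then have fl: "flag u e1 F" "flag u e2 F"
        using F f1 e2 edge_is_facet [OF F] by (simp_all add: flag_def)
      then have "reached u e1 F"
        using e1 by (simp add: C_def)
      then have "reached u e2 F"
        using move(2) flag_in_flags [OF fl(2)] by (simp add: reached_def)
      then show "e2 \<in> C"
        using e2 vertices by (auto simp: C_def)
    qed
    moreover have "e' facet_of F"
      using that(3) edge_is_facet [OF F] by (simp add: flag_def)
    ultimately show ?thesis
      using that(3) by (auto simp: C_def)
  qed
  obtain v0 b0 c0 where "(v0, b0, c0) \<in> R"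
    using R(2) by auto
  moreover obtain e0 F0 where f0: "flag v0 e0 F0" and "b0 = sgn (centre e0)" "c0 = sgn (centre F0)"
    using R(1) calculation in_flagsE by blast
  ultimately have r0: "reached v0 e0 F0"
    by (simp add: reached_def)
  define C where "C = {F. F facet_of P \<and> (\<forall>v e. flag v e F \<longrightarrow> reached v e F)}"
  have "C = {F. F facet_of P}"
  proof (rule facets_connected [OF polytope])
    show "aff_dim P = 2 \<or> aff_dim P = 3"
      by (simp add: dim)
    show "C \<subseteq> {F. F facet_of P}"
      by (auto simp: C_def)
    show "F0 \<in> C"
      using f0 edges [OF f0 r0] by (auto simp: C_def flag_def)
    fix F G assume F: "F \<in> C" and G: "G facet_of P" and "aff_dim (F \<inter> G) = aff_dim P - 2"
    then have ad: "aff_dim (F \<inter> G) = 1"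
      by (simp add: dim)
    have F': "F facet_of P"
      using F by (simp add: C_def)
    have face: "F \<inter> G face_of P"
      using face_of_Int [OF facet_face(1) [OF F'] facet_face(1) [OF G]] .
    have "F \<inter> G edge_of F" "F \<inter> G edge_of G"
      using face_of_subset [OF face] facet_of_imp_subset F' G ad by (auto simp: edge_of_def)
    moreover have "F \<inter> G \<noteq> {}"
    proof
      assume "F \<inter> G = {}"
      then show False
        using ad by simp
    qed
    then obtain v where "v extreme_point_of (F \<inter> G)"
      using polytope_extreme_points(2) [OF face_of_polytope_polytope [OF polytope face]] by auto
    ultimately have fl: "flag v (F \<inter> G) F" "flag v (F \<inter> G) G"
      using F' G by (simp_all add: flag_def)
    then have "reached v (F \<inter> G) F"
      using F by (simp add: C_def)
    then have "reached v (F \<inter> G) G"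
      using move(3) flag_in_flags [OF fl(2)] by (simp add: reached_def)
    then show "G \<in> C"
      using G edges [OF fl(2)] by (simp add: C_def)
  qed
  then have "reached v e F" if "flag v e F" for v e F
    using that by (auto simp: C_def flag_def)
  then have "flags \<subseteq> R"
    by (auto simp: flags_def reached_def)
  with R(1) show ?thesis
    by blast
qed

lemma flag_exists: obtains v e F where "flag v e F"
proof -
  obtain F where F: "F facet_of P"
    by (rule facet_exists)
  obtain v where "v extreme_point_of F"
    using polytope_extreme_points(2) [OF facet_face(4) [OF F] facet_face(2) [OF F]] by auto
  then show thesis
    using vertex_edge [OF F] that by blast
qed

theorem flags_chamber_system: "chamber_system cos_vertex_leg cos_face_leg flags"
  unfolding chamber_system_def
proof (intro conjI allI impI)
  show "flags \<noteq> {}"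
    using flag_exists flag_in_flags by (metis empty_iff)
  show "right_triple cos_vertex_leg cos_face_leg a b c" if "(a, b, c) \<in> flags" for a b c
    using that flag_right_triple by (auto elim: in_flagsE)
  show "\<exists>a'. a' \<noteq> a \<and> (a', b, c) \<in> flags" if "(a, b, c) \<in> flags" for a b c
    using that other_end flag_in_flags by (metis in_flagsE)
  show "\<exists>b'. b' \<noteq> b \<and> (a, b', c) \<in> flags" if abc: "(a, b, c) \<in> flags" for a b c
  proof -
    obtain e F where eF: "flag a e F" "b = sgn (centre e)" "c = sgn (centre F)"
      by (rule in_flagsE [OF abc])
    obtain e' where "centre e' \<noteq> centre e" "flag a e' F"
      by (rule other_edge [OF eF(1)])
    then show ?thesis
      using flag_in_flags flag_sgn_eq(1) [OF eF(1)] eF(2,3) by metis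
  qed
  show "\<exists>c'. c' \<noteq> c \<and> (a, b, c') \<in> flags" if abc: "(a, b, c) \<in> flags" for a b c
  proof -
    obtain e F where eF: "flag a e F" "b = sgn (centre e)" "c = sgn (centre F)"
      by (rule in_flagsE [OF abc])
    obtain G where "centre G \<noteq> centre F" "flag a e G"
      by (rule other_facet [OF eF(1)])
    then show ?thesis
      using flag_in_flags flag_sgn_eq(2) [OF eF(1)] eF(2,3) by metis
  qed
  show "R = flags" if "R \<subseteq> flags" "R \<noteq> {}" "closed_under_adjacency flags R" for R
    using flags_connected that .
qed (fact legs_range)+

subsection \<open>The tiling\<close>

lemma flag_triangle:
  assumes "flag v e F"
  shows "triangle_of (v, sgn (centre e), sgn (centre F)) = sgn ` (convex hull {v, centre e, centre F})"
proof -
  have "convex hull {v, centre e, centre F} \<subseteq> {y. centre F \<bullet> y = \<delta>}"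
  proof (rule hull_minimal)
    show "{v, centre e, centre F} \<subseteq> {y. centre F \<bullet> y = \<delta>}"
      using flag_products(7-9) [OF assms] by (auto simp: inner_commute)
  qed (rule convex_hyperplane)
  then have "0 \<notin> convex hull {v, centre e, centre F}"
    using parameters(3) by auto
  moreover have "0 \<notin> convex hull {v, sgn (centre e), sgn (centre F)}"
    by (rule zero_notin_hull_triple [OF right_triple_basis [OF legs_range flag_right_triple [OF assms]]])
  ultimately show ?thesis
    using parameters unfolding triangle_of_def flag_sgn [OF assms]
    by (simp add: sgn_hull_triple_scale)
qed

lemma solid_tiling_eq: "solid_tiling P = triangle_of ` flags"
proof -
  have "flags = (\<lambda>(v, e, F). (v, sgn (centre e), sgn (centre F))) ` {(v, e, F). flag v e F}"
    by (auto simp: flags_def image_iff; blast)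
  then have "triangle_of ` flags = (\<lambda>(v, e, F). sgn ` (convex hull {v, centre e, centre F})) ` {(v, e, F). flag v e F}"
    by (auto simp: image_image flag_triangle intro!: image_cong)
  also have "\<dots> = solid_tiling P"
    by (auto simp: solid_tiling_def flag_def image_iff)
  finally show ?thesis
    by simp
qed

text \<open>The ray from the origin through a point of the sphere leaves the solid in a face, and inside
this face the ray from its centre leaves it in an edge.\<close>

lemma triangles_cover: "S2 \<subseteq> \<Union>(triangle_of ` flags)"
proof
  fix x :: "real^3" assume "x \<in> S2"
  then have x: "norm x = 1"
    by simp
  then have "x \<noteq> 0"
    by auto
  have rel: "affine hull P = UNIV"
    using dim by (simp add: aff_dim_eq_full [symmetric])
  have "0 \<in> rel_interior P"
    using zero_in_interior rel by (simp add: rel_interior_interior)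
  then obtain d where d: "0 < d" "0 + d *\<^sub>R x \<in> rel_frontier P"
  proof (rule ray_to_rel_frontier [OF polytope_imp_bounded [OF polytope]])
    show "0 + x \<in> affine hull P"
      by (simp add: rel)
  qed (use \<open>x \<noteq> 0\<close> in \<open>auto intro: that\<close>)
  define y where "y = d *\<^sub>R x"
  have sy: "sgn y = x"
    using d(1) x by (simp add: y_def sgn_scaleR sgn_div_norm)
  obtain F where F: "F facet_of P" and yF: "y \<in> F"
    using d(2) rel_frontier_of_polyhedron [OF polytope_imp_polyhedron [OF polytope]] by (auto simp: y_def)
  define c where "c = centre F"
  have c: "c \<in> rel_interior F" "c \<in> F"
    using centre_in_facet [OF F] by (simp_all add: c_def)
  have "\<exists>v e. flag v e F \<and> y \<in> convex hull {v, centre e, c}"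
  proof (cases "y = c")
    case True
    obtain v where "v extreme_point_of F"
      using polytope_extreme_points(2) [OF facet_face(4) [OF F] facet_face(2) [OF F]] by auto
    then obtain e where "flag v e F"
      using vertex_edge [OF F] by blast
    moreover have "y \<in> convex hull {v, centre e, c}"
      using True by (simp add: hull_inc)
    ultimately show ?thesis
      by blast
  next
    case False
    have "c + (y - c) \<in> affine hull F"
      using yF by (simp add: hull_inc)
    then obtain t where t: "0 < t" "c + t *\<^sub>R (y - c) \<in> rel_frontier F"
    proof (rule ray_to_rel_frontier [OF polytope_imp_bounded [OF facet_face(4) [OF F]] c(1)])
      show "y - c \<noteq> 0"
        using False by simp
    qed (auto intro: that)
    define z where "z = c + t *\<^sub>R (y - c)"
    obtain e where e: "e facet_of F" and ze: "z \<in> e"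
      using t(2) rel_frontier_of_polyhedron [OF polytope_imp_polyhedron [OF facet_face(4) [OF F]]]
      by (auto simp: z_def)
    have ef: "e face_of F" "e edge_of F" "e \<noteq> F"
      using e edge_is_facet [OF F] by (auto simp: facet_of_imp_face_of)
    \<comment> \<open>The ray from the centre leaves \<open>F\<close> no earlier than at \<open>y\<close>: a point of the edge \<open>e\<close>
      strictly between \<open>c\<close> and \<open>y\<close> would drag \<open>c\<close> into \<open>e\<close>.\<close>
    have "1 \<le> t"
    proof (rule ccontr)
      assume "\<not> 1 \<le> t"
      then have "z \<in> open_segment c y"
        using t(1) False unfolding in_segment z_def
        by (intro conjI exI [of _ t]) (auto simp: algebra_simps)
      then have "c \<in> e"
        using face_ofD [OF ef(1) _ c(2) yF ze] by blast
      then show False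
        using face_of_disjoint_rel_interior [OF ef(1,3)] c(1) by blast
    qed
    define m where "m = centre e"
    obtain a b where ab: "e = closed_segment a b" "{v. v extreme_point_of e} = {a, b}" "m = (1/2) *\<^sub>R (a + b)"
      unfolding m_def by (rule facet_edge [OF F ef(2)])
    obtain u where u: "0 \<le> u" "u \<le> 1" "z = (1 - u) *\<^sub>R a + u *\<^sub>R b"
      using ze unfolding ab(1) in_segment by blast
    have m2: "s *\<^sub>R m = (s / 2) *\<^sub>R a + (s / 2) *\<^sub>R b" for s
      by (simp add: ab(3) scaleR_add_right)
    have "\<exists>v \<in> {a, b}. z \<in> convex hull {v, m}"
    proof (cases "u \<le> 1/2")
      case True
      have "(1 - 2 * u) *\<^sub>R a = (1 - u) *\<^sub>R a - u *\<^sub>R a"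
        by (simp add: scaleR_diff_left [symmetric])
      then have "z = (1 - 2 * u) *\<^sub>R a + (2 * u) *\<^sub>R m"
        unfolding m2 u(3) by simp
      then have "z \<in> closed_segment a m"
        unfolding in_segment using True u(1) by (intro exI [of _ "2 * u"]) auto
      then show ?thesis
        by (auto simp: segment_convex_hull)
    next
      case False
      have "(1 - (2 - 2 * u)) *\<^sub>R b = u *\<^sub>R b - (1 - u) *\<^sub>R b"
        by (simp add: scaleR_diff_left [symmetric])
      moreover have "(2 - 2 * u) *\<^sub>R m = (1 - u) *\<^sub>R a + (1 - u) *\<^sub>R b"
        unfolding m2 by (simp only: diff_divide_distrib) simp
      ultimately have "z = (1 - (2 - 2 * u)) *\<^sub>R b + (2 - 2 * u) *\<^sub>R m"
        unfolding u(3) by simp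
      then have "z \<in> closed_segment b m"
        unfolding in_segment using False u(2) by (intro exI [of _ "2 - 2 * u"]) auto
      then show ?thesis
        by (auto simp: segment_convex_hull)
    qed
    then obtain v where v: "v \<in> {a, b}" "z \<in> convex hull {v, m}"
      by blast
    have "v extreme_point_of e"
      using v(1) ab(2) by blast
    then have fl: "flag v e F"
      using F ef(2) by (simp add: flag_def)
    have zc: "z \<in> convex hull {v, m, c}" "c \<in> convex hull {v, m, c}"
      using v(2) hull_mono [of "{v, m}" "{v, m, c}" convex] by (auto simp: hull_inc)
    have "y = (1 - 1 / t) *\<^sub>R c + (1 / t) *\<^sub>R z"
      using t(1) by (simp add: z_def algebra_simps)
    moreover have "0 \<le> 1 - 1 / t" "0 \<le> 1 / t"
      using \<open>1 \<le> t\<close> by simp_all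
    ultimately have "y \<in> convex hull {v, m, c}"
      using convexD [OF convex_convex_hull zc(2,1), of "1 - 1 / t" "1 / t"] by simp
    then show ?thesis
      using fl m_def by blast
  qed
  then obtain v e where fl: "flag v e F" and "y \<in> convex hull {v, centre e, centre F}"
    by (auto simp: c_def)
  then have "x \<in> triangle_of (v, sgn (centre e), sgn (centre F))"
    unfolding flag_triangle [OF fl] using sy by blast
  then show "x \<in> \<Union>(triangle_of ` flags)"
    using flag_in_flags [OF fl] by blast
qed

lemma inner_less_square:
  fixes u w :: "real^3"
  assumes "u \<bullet> u = s" "w \<bullet> w = s" "u \<noteq> w"
  shows "u \<bullet> w < s"
proof -
  have "0 < (u - w) \<bullet> (u - w)"
    using assms(3) by simp
  then show ?thesis
    using assms(1,2) by (simp add: inner_diff_left inner_diff_right inner_commute)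
qed

text \<open>The inner product with the centre of \<open>F\<close> attains its maximum \<open>\<delta>\<close> over the solid at all points
of \<open>F\<close>, whereas the centre of a different face has a smaller inner product with the centre of
\<open>F\<close>. So at \<open>x\<close> the centre of \<open>F\<close> beats the centres of all other faces. In the same way the
midpoint of \<open>e\<close> beats the midpoints of the other edges of \<open>F\<close>, and \<open>v\<close> beats the other end
of \<open>e\<close>.\<close>

lemma interior_determines_flag:
  assumes fl: "flag v e F" and fl': "flag v' e' F'"
    and pos: "0 < k" "0 < l" "0 < n" and x: "x = k *\<^sub>R v + l *\<^sub>R centre e + n *\<^sub>R centre F"
    and pos': "0 < k'" "0 < l'" "0 < n'" and x': "x = k' *\<^sub>R v' + l' *\<^sub>R centre e' + n' *\<^sub>R centre F'"
  shows "v = v' \<and> centre e = centre e' \<and> centre F = centre F'"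
proof -
  have facet: "centre G \<bullet> x < centre F \<bullet> x"
    if "flag v e F" "0 < k" "0 < l" "0 < n" "x = k *\<^sub>R v + l *\<^sub>R centre e + n *\<^sub>R centre F"
      "flag u d G" "centre G \<noteq> centre F" for v e F u d G k l n
  proof -
    note g = flag_products [OF that(1)]
    have G: "G facet_of P"
      using that(6) by (simp add: flag_def)
    have "centre G \<bullet> v \<le> \<delta>" "centre G \<bullet> centre e \<le> \<delta>"
      using facet_supports [OF G] g by auto
    moreover have "centre G \<bullet> centre F < \<delta>"
      using inner_less_square [OF facet_centre_norm(1) [OF G] g(9) that(7)] .
    ultimately have "k * (centre G \<bullet> v) + l * (centre G \<bullet> centre e) + n * (centre G \<bullet> centre F)
        < k * \<delta> + l * \<delta> + n * \<delta>"
      using that(2-4) by (intro add_le_less_mono add_mono mult_left_mono mult_strict_left_mono) auto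
    moreover have "centre F \<bullet> v = \<delta>" "centre F \<bullet> centre e = \<delta>"
      using g(7,8) by (simp_all only: inner_commute)
    ultimately show ?thesis
      using g(9) unfolding that(5) by (simp add: inner_add_right)
  qed
  have cc: "centre F = centre F'"
    using facet [OF fl pos x fl'] facet [OF fl' pos' x' fl] by force
  then have FF: "F = F'"
    using fl fl' facet_eq_if_centre_eq by (simp add: flag_def)
  have edge: "centre d \<bullet> x < centre e \<bullet> x"
    if "flag v e F" "0 < k" "0 < l" "0 < n" "x = k *\<^sub>R v + l *\<^sub>R centre e + n *\<^sub>R centre F"
      "flag u d F" "centre d \<noteq> centre e" for v e u d k l n
  proof -
    note g = flag_products [OF that(1)] and h = flag_products [OF that(6)]
    have "centre d \<bullet> v \<le> \<mu>"
      using edge_supports [OF that(6) g(11)] g(7) inner_commute [of "centre F" v] by (simp add: inner_diff_left)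
    moreover have "centre d \<bullet> centre e < \<mu>"
      using inner_less_square [OF h(6) g(6) that(7)] .
    ultimately have "k * (centre d \<bullet> v) + l * (centre d \<bullet> centre e) < k * \<mu> + l * \<mu>"
      using that(2,3) by (intro add_le_less_mono mult_left_mono mult_strict_left_mono) auto
    moreover have "centre e \<bullet> v = \<mu>"
      using g(5) by (simp only: inner_commute)
    ultimately show ?thesis
      using g(6,8) h(8) unfolding that(5) by (simp add: inner_add_right)
  qed
  have mm: "centre e = centre e'"
    using edge [OF fl pos x, of v' e'] edge [OF fl' [folded FF] pos' x' [folded FF], of v e] fl fl' FF by force
  have "e = e'"
  proof (rule face_eq_if_centre_eq)
    show "polytope F"
      using fl facet_face(4) by (simp add: flag_def)
    show "e face_of F" "e' face_of F" "e \<noteq> {}" "e' \<noteq> {}"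
      using fl fl' FF by (auto simp: flag_def edge_of_def)
  qed (fact mm)
  have vertex: "w \<bullet> x < v \<bullet> x"
    if "flag v e F" "0 < k" "x = k *\<^sub>R v + l *\<^sub>R centre e + n *\<^sub>R centre F" "flag w e F" "w \<noteq> v" for v w k l n
  proof -
    note g = flag_products [OF that(1)] and h = flag_products [OF that(4)]
    have "w \<bullet> v < 1"
      using g(4) h(4) that(5) by (intro inner_less_square) (auto simp: norm_eq_1)
    then have "k * (w \<bullet> v) < k * (v \<bullet> v)"
      using that(2) g(4) by (simp add: norm_eq_1)
    then show ?thesis
      using g(5,7) h(5,7) unfolding that(3) by (simp add: inner_add_right)
  qed
  have "v = v'"
    using vertex [OF fl pos(1) x, of v'] vertex [OF fl' [folded FF \<open>e = e'\<close>] pos'(1), of l' n' v]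
      x' fl fl' FF \<open>e = e'\<close> by force
  with cc mm show ?thesis
    by blast
qed

lemma tile_interior:
  assumes fl: "flag v e F" and x: "x \<in> top_of_set S2 interior_of triangle_of (v, sgn (centre e), sgn (centre F))"
  obtains k l n where "0 < k" "0 < l" "0 < n" "x = k *\<^sub>R v + l *\<^sub>R centre e + n *\<^sub>R centre F"
proof -
  obtain k l n where "0 < k" "0 < l" "0 < n" "x = k *\<^sub>R v + l *\<^sub>R sgn (centre e) + n *\<^sub>R sgn (centre F)"
    using x sgn_hull_triple_interior [OF right_triple_basis [OF legs_range flag_right_triple [OF fl]]]
    by (auto simp: triangle_of_def)
  then show thesis
    using that [of k "l / sqrt \<mu>" "n / sqrt \<delta>"] parameters by (simp add: flag_sgn [OF fl])
qed

theorem flags_tiling: "tiling (triangle_of ` flags)"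
  unfolding tiling_def
proof (intro conjI ballI)
  have poly: "spherical_polygon (triangle_of (v, sgn (centre e), sgn (centre F)))" if "flag v e F" for v e F
    using flag_right_triple [OF that] unfolding triangle_of_def
    by (auto simp: right_triple_def intro!: spherical_polygon_triangle right_triple_basis [OF legs_range flag_right_triple [OF that]])
  then show polygon: "spherical_polygon t" if "t \<in> triangle_of ` flags" for t
    using that by (auto simp: flags_def)
  then have "\<Union>(triangle_of ` flags) \<subseteq> S2"
    by (meson Union_least spherical_polygon_def)
  then show "\<Union>(triangle_of ` flags) = S2"
    using triangles_cover by blast
  show "pairwise (\<lambda>t \<tau>. disjnt (top_of_set S2 interior_of t) (top_of_set S2 interior_of \<tau>)) (triangle_of ` flags)"
  proof (rule pairwiseI)
    fix t \<tau> assume t: "t \<in> triangle_of ` flags" and \<tau>: "\<tau> \<in> triangle_of ` flags" and ne: "t \<noteq> \<tau>"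
    obtain v e F where fl: "flag v e F" "t = triangle_of (v, sgn (centre e), sgn (centre F))"
      using t unfolding flags_def by blast
    obtain v' e' F' where fl': "flag v' e' F'" "\<tau> = triangle_of (v', sgn (centre e'), sgn (centre F'))"
      using \<tau> unfolding flags_def by blast
    show "disjnt (top_of_set S2 interior_of t) (top_of_set S2 interior_of \<tau>)"
      unfolding disjnt_iff
    proof (intro allI notI)
      fix x assume x: "x \<in> top_of_set S2 interior_of t \<and> x \<in> top_of_set S2 interior_of \<tau>"
      obtain k l n where x1: "0 < k" "0 < l" "0 < n" "x = k *\<^sub>R v + l *\<^sub>R centre e + n *\<^sub>R centre F"
        using x tile_interior [OF fl(1)] unfolding fl(2) by blast
      obtain k' l' n' where x2: "0 < k'" "0 < l'" "0 < n'" "x = k' *\<^sub>R v' + l' *\<^sub>R centre e' + n' *\<^sub>R centre F'"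
        using x tile_interior [OF fl'(1)] unfolding fl'(2) by blast
      show False
        using interior_determines_flag [OF fl(1) fl'(1) x1 x2] ne fl(2) fl'(2) by simp
    qed
  qed
qed

subsection \<open>The angles\<close>

lemma angle_at_face_centre: "right_angle_at cos_face_leg cos_vertex_leg = pi / real p"
proof -
  let ?c = "cos (pi / real p)"
  have "pi / real p < pi / 2"
    using parameters(1) by (intro divide_strict_left_mono) auto
  then have c: "0 < ?c"
    using parameters(1) by (intro cos_gt_zero) auto
  have "0 < 1 - \<delta>"
    using parameters by simp
  have "\<mu> - \<delta> = r\<^sup>2 * ?c\<^sup>2"
    by (simp add: \<mu>_def \<delta>_def cos_squared_eq algebra_simps)
  moreover have "1 - \<delta> = r\<^sup>2"
    by (simp add: \<delta>_def)
  ultimately have quot: "(\<mu> - \<delta>) / (1 - \<delta>) = ?c\<^sup>2"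
    using \<open>0 < 1 - \<delta>\<close> by simp
  have "cos_vertex_leg * sqrt (1 - cos_face_leg\<^sup>2) = sqrt (\<mu> * (1 - \<delta> / \<mu>))"
    by (simp add: legs_square cos_vertex_leg_def real_sqrt_mult)
  also have "\<mu> * (1 - \<delta> / \<mu>) = \<mu> - \<delta>"
    using parameters by (simp add: right_diff_distrib)
  finally have "cos_vertex_leg * sqrt (1 - cos_face_leg\<^sup>2) / sqrt (1 - cos_face_leg\<^sup>2 * cos_vertex_leg\<^sup>2) = sqrt ((\<mu> - \<delta>) / (1 - \<delta>))"
    using parameters by (simp add: legs_square real_sqrt_divide)
  also have "\<dots> = ?c"
    unfolding quot using c by simp
  finally show ?thesis
    unfolding right_angle_at_def using parameters(1) by (simp add: arccos_cos field_simps)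
qed

text \<open>The solid lies on one side of the plane of each of its faces, which is the assumption that the
count of the faces around a vertex requires.\<close>

lemma angle_at_vertex: "right_angle_at cos_vertex_leg cos_face_leg = pi / real q"
proof -
  obtain v e F where fl: "flag v e F"
    by (rule flag_exists)
  have sup: "b \<bullet> c' \<le> cos_face_leg" if bc: "(v, b, c) \<in> flags" and bc': "(v, b', c') \<in> flags" for b c b' c'
  proof -
    obtain e F where 1: "flag v e F" "b = sgn (centre e)" "c = sgn (centre F)"
      by (rule in_flagsE [OF bc])
    obtain e' F' where 2: "flag v e' F'" "b' = sgn (centre e')" "c' = sgn (centre F')"
      by (rule in_flagsE [OF bc'])
    have "centre F' \<bullet> centre e \<le> \<delta>"
      using facet_supports flag_products(3) [OF 1(1)] 2(1) by (simp add: flag_def)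
    then have "b \<bullet> c' \<le> \<delta> / sqrt \<delta> / sqrt \<mu>"
      using parameters unfolding 1(2) 2(3) flag_sgn(1) [OF 1(1)] flag_sgn(2) [OF 2(1)]
      by (simp add: inner_commute divide_right_mono mult.commute [of "sqrt \<mu>" "sqrt \<delta>"])
    then show ?thesis
      using parameters by (simp add: real_div_sqrt cos_face_leg_def real_sqrt_divide)
  qed
  have "{c. \<exists>b. (v, b, c) \<in> flags} = (\<lambda>F. sgn (centre F)) ` {F. F facet_of P \<and> v \<in> F}"
  proof (intro equalityI subsetI)
    fix c assume "c \<in> {c. \<exists>b. (v, b, c) \<in> flags}"
    then obtain e F where "flag v e F" "c = sgn (centre F)"
      by (auto elim: in_flagsE)
    then show "c \<in> (\<lambda>F. sgn (centre F)) ` {F. F facet_of P \<and> v \<in> F}"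
      using flag_products(11) by (auto simp: flag_def)
  next
    fix c assume "c \<in> (\<lambda>F. sgn (centre F)) ` {F. F facet_of P \<and> v \<in> F}"
    then obtain G where G: "G facet_of P" "v \<in> G" "c = sgn (centre G)"
      by auto
    then have "v extreme_point_of G"
      using flag_products(13) [OF fl] facet_vertex by blast
    then obtain d where "flag v d G"
      using vertex_edge [OF G(1)] by blast
    then show "c \<in> {c. \<exists>b. (v, b, c) \<in> flags}"
      using flag_in_flags G(3) by blast
  qed
  moreover have "inj_on (\<lambda>F. sgn (centre F)) {F. F facet_of P \<and> v \<in> F}"
  proof (rule inj_onI)
    fix F G assume FG: "F \<in> {F. F facet_of P \<and> v \<in> F}" "G \<in> {F. F facet_of P \<and> v \<in> F}"
      "sgn (centre F) = sgn (centre G)"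
    have "norm (centre F) = sqrt \<delta>" "norm (centre G) = sqrt \<delta>"
      unfolding norm_eq_sqrt_inner using facet_centre_norm(1) FG by simp_all
    then have "centre F = centre G"
      using FG(3) parameters by (simp add: sgn_div_norm)
    then show "F = G"
      using facet_eq_if_centre_eq FG by simp
  qed
  ultimately have "card {c. \<exists>b. (v, b, c) \<in> flags} = q"
    using vertices [OF flag_products(13) [OF fl]] by (simp add: card_image)
  then have *: "real q * right_angle_at cos_vertex_leg cos_face_leg = pi"
    using vertex_angle_count [OF flags_chamber_system flag_in_flags [OF fl] sup] by simp
  then have "0 < q"
    by (cases q) auto
  then show "right_angle_at cos_vertex_leg cos_face_leg = pi / real q"
    using * by (simp add: field_simps)
qed

end

section \<open>The five solids\<close>

text \<open>The legs are expressed through the angles because in this form they depend only on \<open>p\<close> and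
\<open>q\<close>, and are interchanged when \<open>p\<close> and \<open>q\<close> are.\<close>

lemma platonic_flags:
  assumes "platonic_solid p q P" "concentrically_inscribed P"
  obtains \<Phi> where
    "chamber_system (cos (pi / real p) / sin (pi / real q)) (cos (pi / real q) / sin (pi / real p)) \<Phi>"
    "right_angle_at (cos (pi / real p) / sin (pi / real q)) (cos (pi / real q) / sin (pi / real p)) = pi / real q"
    "right_angle_at (cos (pi / real q) / sin (pi / real p)) (cos (pi / real p) / sin (pi / real q)) = pi / real p"
    "solid_tiling P = triangle_of ` \<Phi>" "tiling (solid_tiling P)"
proof -
  obtain r where "inscribed_solid p q r P"
    using assms unfolding platonic_solid_def concentrically_inscribed_def inscribed_solid_def by auto
  then interpret inscribed_solid p q r P .
  have "cos_vertex_leg = cos (pi / real p) / sin (pi / real q)"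
    using sides_from_angles [OF legs_range] by (simp only: angle_at_face_centre angle_at_vertex)
  moreover have "cos_face_leg = cos (pi / real q) / sin (pi / real p)"
    using sides_from_angles [OF legs_range(3,4,1,2)] by (simp only: angle_at_face_centre angle_at_vertex)
  ultimately show thesis
    using that [of flags] flags_chamber_system angle_at_vertex angle_at_face_centre solid_tiling_eq flags_tiling
    by simp
qed

text \<open>The angles \<open>pi / p\<close> and \<open>pi / q\<close> are stated in both orders because the angle \<open>pi / 3\<close> lies at
the centre of a face for some of the solids and at a vertex for others.\<close>

theorem platonic_tiling:
  assumes "platonic_solid p q P" "concentrically_inscribed P"
  shows "symmetric_tiling (solid_tiling P)"
    and "\<exists>Q. prototile (solid_tiling P) Q \<and> spherical_triangle Q (pi/2) (pi / real p) (pi / real q)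
      \<and> spherical_triangle Q (pi/2) (pi / real q) (pi / real p)"
proof -
  obtain \<Phi> x z where \<Phi>: "chamber_system x z \<Phi>" "right_angle_at x z = pi / real q" "right_angle_at z x = pi / real p"
    and T: "solid_tiling P = triangle_of ` \<Phi>" "tiling (solid_tiling P)"
    by (rule platonic_flags [OF assms])
  show sym: "symmetric_tiling (solid_tiling P)"
    using chamber_tiling_symmetric [OF \<Phi>(1)] T by simp
  obtain a b c where abc: "(a, b, c) \<in> \<Phi>"
    using chamber_systemD(5) [OF \<Phi>(1)] by auto
  define Q where "Q = triangle_of (a, b, c)"
  have Q: "Q = sgn ` (convex hull {a, b, c})" "Q \<in> solid_tiling P"
    using abc by (auto simp: Q_def triangle_of_def T(1))
  have xz: "0 < x" "x < 1" "0 < z" "z < 1"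
    using chamber_systemD(1-4) [OF \<Phi>(1)] by simp_all
  have rt: "right_triple x z a b c"
    by (rule chamber_systemD(6) [OF \<Phi>(1) abc])
  note basis = right_triple_basis [OF xz rt]
  have S2: "a \<in> S2" "b \<in> S2" "c \<in> S2"
    using rt by (auto simp: right_triple_def)
  have angles: "sph_angle a b c = pi/2" "sph_angle b a c = pi / real q" "sph_angle b c a = pi / real p"
    using right_triple_right_angle [OF rt] right_triple_angle [OF xz rt]
      right_triple_angle [OF xz(3,4,1,2) right_triple_rev [OF rt]] \<Phi> by simp_all
  have "spherical_triangle Q (pi/2) (pi / real p) (pi / real q)"
    unfolding spherical_triangle_def
  proof (intro bexI conjI)
    show "card {b, c, a} = 3" "independent {b, c, a}" "Q = sgn ` (convex hull {b, c, a})"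
      using basis Q(1) by (simp_all add: insert_commute)
    show "sph_angle c b a = pi/2" "sph_angle b c a = pi / real p" "sph_angle b a c = pi / real q"
      using angles sph_angle_commute by metis+
  qed (fact S2)+
  moreover have "spherical_triangle Q (pi/2) (pi / real q) (pi / real p)"
    unfolding spherical_triangle_def
  proof (intro bexI conjI)
    show "card {b, a, c} = 3" "independent {b, a, c}" "Q = sgn ` (convex hull {b, a, c})"
      using basis Q(1) by (simp_all add: insert_commute)
    show "sph_angle a b c = pi/2" "sph_angle b a c = pi / real q" "sph_angle b c a = pi / real p"
      by (fact angles)+
  qed (fact S2)+
  moreover have "prototile (solid_tiling P) Q"
    using sym Q(2) unfolding prototile_def symmetric_tiling_def tiling_def by metis
  ultimately show "\<exists>Q. prototile (solid_tiling P) Q \<and> spherical_triangle Q (pi/2) (pi / real p) (pi / real q)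
      \<and> spherical_triangle Q (pi/2) (pi / real q) (pi / real p)"
    by blast
qed

text \<open>Reversing its flags turns the second solid into a chamber system with the same legs as the
flags of the first one, and leaves its tiles as they are.\<close>

theorem dual_platonic_tilings_same:
  assumes "platonic_solid p q P" "concentrically_inscribed P"
    and "platonic_solid q p P'" "concentrically_inscribed P'"
  shows "same_up_to_isometry (solid_tiling P) (solid_tiling P')"
proof -
  define x z where "x = cos (pi / real p) / sin (pi / real q)" and "z = cos (pi / real q) / sin (pi / real p)"
  obtain \<Phi> where \<Phi>: "chamber_system x z \<Phi>" "solid_tiling P = triangle_of ` \<Phi>"
    unfolding x_def z_def by (rule platonic_flags [OF assms(1,2)])
  obtain \<Psi> where \<Psi>: "chamber_system z x \<Psi>" "solid_tiling P' = triangle_of ` \<Psi>"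
    unfolding x_def z_def by (rule platonic_flags [OF assms(3,4)])
  have "same_up_to_isometry (triangle_of ` \<Phi>) (triangle_of ` rev_chamber ` \<Psi>)"
    by (rule chamber_tilings_same [OF \<Phi>(1) chamber_system_rev [OF \<Psi>(1)]])
  then show ?thesis
    by (simp only: triangle_of_rev_image \<Phi>(2) \<Psi>(2))
qed

theorem theorem4p4:
  shows
    "(\<forall>P. tetrahedron P \<and> concentrically_inscribed P \<longrightarrow>
        symmetric_tiling (solid_tiling P) \<and>
        (\<exists>Q. prototile (solid_tiling P) Q \<and> spherical_triangle Q (pi/2) (pi/3) (pi/3))) \<and>

     (\<forall>P. (cube P \<or> octahedron P) \<and> concentrically_inscribed P \<longrightarrow>
        symmetric_tiling (solid_tiling P) \<and>
        (\<exists>Q. prototile (solid_tiling P) Q \<and> spherical_triangle Q (pi/2) (pi/3) (pi/4))) \<and>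
     (\<forall>P P'. cube P \<and> octahedron P' \<and>
        concentrically_inscribed P \<and> concentrically_inscribed P' \<longrightarrow>
        same_up_to_isometry (solid_tiling P) (solid_tiling P')) \<and>

     (\<forall>P. (dodecahedron P \<or> icosahedron P) \<and> concentrically_inscribed P \<longrightarrow>
        symmetric_tiling (solid_tiling P) \<and>
        (\<exists>Q. prototile (solid_tiling P) Q \<and> spherical_triangle Q (pi/2) (pi/3) (pi/5))) \<and>
     (\<forall>P P'. dodecahedron P \<and> icosahedron P' \<and>
        concentrically_inscribed P \<and> concentrically_inscribed P' \<longrightarrow>
        same_up_to_isometry (solid_tiling P) (solid_tiling P'))"
proof -
  have tiling: "symmetric_tiling (solid_tiling P) \<and>
      (\<exists>Q. prototile (solid_tiling P) Q \<and> spherical_triangle Q (pi/2) (pi/3) (pi / real q))"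
    if "platonic_solid 3 q P \<or> platonic_solid q 3 P" "concentrically_inscribed P" for P q
    using that platonic_tiling [of 3 q P] platonic_tiling [of q 3 P] by auto
  have t3: "platonic_solid 3 3 P \<Longrightarrow> concentrically_inscribed P \<Longrightarrow> symmetric_tiling (solid_tiling P) \<and>
      (\<exists>Q. prototile (solid_tiling P) Q \<and> spherical_triangle Q (pi/2) (pi/3) (pi/3))" for P
    using tiling [of 3 P] by simp
  have t4: "platonic_solid 4 3 P \<or> platonic_solid 3 4 P \<Longrightarrow> concentrically_inscribed P \<Longrightarrow>
      symmetric_tiling (solid_tiling P) \<and>
      (\<exists>Q. prototile (solid_tiling P) Q \<and> spherical_triangle Q (pi/2) (pi/3) (pi/4))" for P
    using tiling [of 4 P] by (simp add: disj_commute)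
  have t5: "platonic_solid 5 3 P \<or> platonic_solid 3 5 P \<Longrightarrow> concentrically_inscribed P \<Longrightarrow>
      symmetric_tiling (solid_tiling P) \<and>
      (\<exists>Q. prototile (solid_tiling P) Q \<and> spherical_triangle Q (pi/2) (pi/3) (pi/5))" for P
    using tiling [of 5 P] by (simp add: disj_commute)
  show ?thesis
    unfolding tetrahedron_def cube_def octahedron_def dodecahedron_def icosahedron_def
    by (intro conjI allI impI t3 [THEN conjunct1] t3 [THEN conjunct2] t4 [THEN conjunct1] t4 [THEN conjunct2]
        t5 [THEN conjunct1] t5 [THEN conjunct2] dual_platonic_tilings_same; blast)
qed

end
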